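(* Let $(U,\{\mathcal H_n\}_{n\in\mathbb Z})$ be a one-dimensional quantum walk. For each $k=1,2,3,4$ there exists a one-dimensional quantum walk in the class $\mathcal C_k$ that is unitary equivalent to $(U,\{\mathcal H_n\}_{n\in\mathbb Z})$.
   Context: A quantum walk is a pair $(U,\{\mathcal H_v\}_{v\in V})$ where $V$ is a countable set, $\{\mathcal H_v\}_{v\in V}$ is a family of separable Hilbert spaces, and $U$ is a unitary operator on $\mathcal H=\bigoplus_{v\in V}\mathcal H_v$. $P_v$ is the orthogonal projection of $\mathcal H$ onto $\mathcal H_v$ and $U_{uv}=U_{u,v}=P_uUP_v$. The graph $(V,D)$ of the walk is the directed (multi)graph in which the number of directed edges from $v$ to $u$ is $\mathrm{card}(u,v)=\operatorname{rank}U_{uv}$. A quantum walk is one-dimensional if $V=\mathbb Z$, $\dim\mathcal H_n=2$ for all $n$, and its graph has edge set $D=\{(n,n+1),(n+1,n):n\in\mathbb Z\}$ with $\mathrm{card}(n,n+1)=\mathrm{card}(n+1,n)=1$ for all $n$ (so $U_{m,n}$ has rank $1$ if $|m-n|=1$ and is $0$ otherwise). Two quantum walks $(U_1,\{\mathcal H^{(1)}_{v}\}_{v\in V_1})$ and $(U_2,\{\mathcal H^{(2)}_{v}\}_{v\in V_2})$ are unitary equivalent if there are a unitary $W:\bigoplus_{v\in V_1}\mathcal H^{(1)}_v\to\bigoplus_{v\in V_2}\mathcal H^{(2)}_v$ and a bijection $\phi:V_1\to V_2$ with $W\mathcal H^{(1)}_{v}=\mathcal H^{(2)}_{\phi(v)}$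 for all $v\in V_1$ and $WU_1W^*=U_2$. The classes $\mathcal C_1,\dots,\mathcal C_4$ consist of one-dimensional quantum walks with $\mathcal H_n=\mathbb C^2$ for all $n$. For a $2\times2$ matrix $A$, $|m\rangle\langle n|\otimes A$ denotes the operator that sends $\xi\in\mathcal H_n=\mathbb C^2$ to $A\xi\in\mathcal H_m=\mathbb C^2$ and vanishes on $\mathcal H_l$ for $l\ne n$. A one-dimensional quantum walk (in particular $U$ is unitary) with $\mathcal H_n=\mathbb C^2$ belongs to $\mathcal C_k$ if there are complex numbers $a_n,b_n,c_n,d_n$ ($n\in\mathbb Z$) such that for all $n\in\mathbb Z$: $\mathcal C_1$ (Ambainis type): $U_{n-1,n}=|n-1\rangle\langle n|\otimes\begin{bmatrix}a_n&b_n\\0&0\end{bmatrix}$, $U_{n+1,n}=|n+1\rangle\langle n|\otimes\begin{bmatrix}0&0\\c_n&d_n\end{bmatrix}$; $\mathcal C_2$ (Gudder type): $U_{n-1,n}=|n-1\rangle\langle n|\otimes\begin{bmatrix}a_n&0\\c_n&0\end{bmatrix}$, $U_{n+1,n}=|n+1\rangle\langle n|\otimes\begin{bmatrix}0&b_n\\0&d_n\end{bmatrix}$; $\mathcal C_3$: $U_{n-1,n}=|n-1\rangle\langle n|\otimes\begin{bmatrix}0&0\\c_n&d_n\end{bmatrix}$, $U_{n+1,n}=|n+1\rangle\langle n|\otimes\begin{bmatrix}a_n&b_n\\0&0\end{bmatrix}$; $\mathcal C_4$: $U_{n-1,n}=|n-1\rangle\langle n|\otimes\begin{bmatrix}0&b_n\\0&d_n\end{bmatrix}$,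 $U_{n+1,n}=|n+1\rangle\langle n|\otimes\begin{bmatrix}a_n&0\\c_n&0\end{bmatrix}$. *)

theory Defs
  imports "HOL-Analysis.Analysis" "HOL-Algebra.Module" "HOL-Algebra.Algebraic_Closure_Type"
    "HOL-Library.Extended_Nat"
begin

section \<open>Hilbert spaces\<close>

text \<open>
  Complex inner product spaces are carrier-based, so that a family of Hilbert spaces may have a
  different carrier, linear structure and inner product at every index. The ring fields
  \<open>mult\<close> and \<open>one\<close> inherited from the \<open>module\<close> record play no role.
  Inner products are conjugate linear in the first and linear in the second argument.
\<close>

record 'a inner_space = "(complex, 'a) module" +
  hinner :: "'a \<Rightarrow> 'a \<Rightarrow> complex"

definition hnorm :: "'a inner_space \<Rightarrow> 'a \<Rightarrow> real" where
  "hnorm H x = sqrt (Re (hinner H x x))"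

text \<open>The value outside the carrier is fixed because the library's \<open>Metric_space\<close>
  asks for nonnegativity and symmetry on the whole type.\<close>

definition hdist :: "'a inner_space \<Rightarrow> 'a \<Rightarrow> 'a \<Rightarrow> real" where
  "hdist H x y =
     (if x \<in> carrier H \<and> y \<in> carrier H then hnorm H (x \<ominus>\<^bsub>H\<^esub> y) else 0)"

locale hilbert_space =
  module "ring_of_type_algebra :: complex ring" H for H :: "'a inner_space" (structure) +
  assumes hinner_commute:
      "\<lbrakk>x \<in> carrier H; y \<in> carrier H\<rbrakk> \<Longrightarrow> hinner H y x = cnj (hinner H x y)"
    and hinner_add_right:
      "\<lbrakk>x \<in> carrier H; y \<in> carrier H; z \<in> carrier H\<rbrakk> \<Longrightarrow>
        hinner H x (y \<oplus>\<^bsub>H\<^esub> z) = hinner H x y + hinner H x z"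
    and hinner_smult_right:
      "\<lbrakk>x \<in> carrier H; y \<in> carrier H\<rbrakk> \<Longrightarrow>
        hinner H x (a \<odot>\<^bsub>H\<^esub> y) = a * hinner H x y"
    and hinner_pos:
      "\<lbrakk>x \<in> carrier H; x \<noteq> \<zero>\<^bsub>H\<^esub>\<rbrakk> \<Longrightarrow> Re (hinner H x x) > 0"
    and complete: "Metric_space.mcomplete (carrier H) (hdist H)"

definition separable_hilbert_space :: "'a inner_space \<Rightarrow> bool" where
  "separable_hilbert_space H \<longleftrightarrow>
     hilbert_space H \<and> separable_space (Metric_space.mtopology (carrier H) (hdist H))"

definition lincomb :: "'a inner_space \<Rightarrow> ('a \<Rightarrow> complex) \<Rightarrow> 'a set \<Rightarrow> 'a" where
  "lincomb H c A = finsum H (\<lambda>x. c x \<odot>\<^bsub>H\<^esub> x) A"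

definition lin_span :: "'a inner_space \<Rightarrow> 'a set \<Rightarrow> 'a set" where
  "lin_span H B = {lincomb H c A | c A. finite A \<and> A \<subseteq> B}"

definition lin_indep :: "'a inner_space \<Rightarrow> 'a set \<Rightarrow> bool" where
  "lin_indep H B \<longleftrightarrow>
     (\<forall>A c. finite A \<and> A \<subseteq> B \<and> lincomb H c A = \<zero>\<^bsub>H\<^esub> \<longrightarrow> (\<forall>x\<in>A. c x = 0))"

definition lin_basis :: "'a inner_space \<Rightarrow> 'a set \<Rightarrow> 'a set \<Rightarrow> bool" where
  "lin_basis H S B \<longleftrightarrow> B \<subseteq> S \<and> lin_indep H B \<and> lin_span H B = S"

text \<open>Dimension of a linear subspace \<open>S\<close>. All bases have the same cardinality, so the
  infimum is over a single value if there is a finite basis; otherwise it is \<open>Inf {} = \<infinity>\<close>.\<close>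

definition hdim :: "'a inner_space \<Rightarrow> 'a set \<Rightarrow> enat" where
  "hdim H S = Inf {enat (card B) | B. finite B \<and> lin_basis H S B}"

definition rank_op :: "'a inner_space \<Rightarrow> 'b inner_space \<Rightarrow> ('a \<Rightarrow> 'b) \<Rightarrow> enat" where
  "rank_op H K T = hdim K (T ` carrier H)"

definition unitary :: "'a inner_space \<Rightarrow> 'b inner_space \<Rightarrow> ('a \<Rightarrow> 'b) \<Rightarrow> bool" where
  "unitary H K W \<longleftrightarrow>
     bij_betw W (carrier H) (carrier K) \<and>
     (\<forall>x\<in>carrier H. \<forall>y\<in>carrier H. W (x \<oplus>\<^bsub>H\<^esub> y) = W x \<oplus>\<^bsub>K\<^esub> W y) \<and>
     (\<forall>a. \<forall>x\<in>carrier H. W (a \<odot>\<^bsub>H\<^esub> x) = a \<odot>\<^bsub>K\<^esub> W x) \<and>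
     (\<forall>x\<in>carrier H. \<forall>y\<in>carrier H. hinner K (W x) (W y) = hinner H x y)"

definition adjoint_op ::
  "'a inner_space \<Rightarrow> 'b inner_space \<Rightarrow> ('a \<Rightarrow> 'b) \<Rightarrow> 'b \<Rightarrow> 'a" where
  "adjoint_op H K W y =
     (THE x. x \<in> carrier H \<and> (\<forall>z\<in>carrier H. hinner H z x = hinner K (W z) y))"

text \<open>The condition says that \<open>x - y\<close> is orthogonal to \<open>S\<close>.\<close>

definition orth_proj :: "'a inner_space \<Rightarrow> 'a set \<Rightarrow> 'a \<Rightarrow> 'a" where
  "orth_proj H S x = (THE y. y \<in> S \<and> (\<forall>z\<in>S. hinner H z y = hinner H z x))"

text \<open>The Hilbert space direct sum consists of the square summable families.\<close>

definition hilbert_sum :: "'v set \<Rightarrow> ('v \<Rightarrow> 'a inner_space) \<Rightarrow> ('v \<Rightarrow> 'a) inner_space" where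
  "hilbert_sum V H =
     \<lparr>carrier = {f \<in> (\<Pi>\<^sub>E v\<in>V. carrier (H v)). (\<lambda>v. (hnorm (H v) (f v))\<^sup>2) summable_on V},
      monoid.mult = undefined,
      one = undefined,
      zero = (\<lambda>v\<in>V. \<zero>\<^bsub>H v\<^esub>),
      add = (\<lambda>f g. \<lambda>v\<in>V. f v \<oplus>\<^bsub>H v\<^esub> g v),
      smult = (\<lambda>a f. \<lambda>v\<in>V. a \<odot>\<^bsub>H v\<^esub> f v),
      hinner = (\<lambda>f g. \<Sum>\<^sub>\<infinity>v\<in>V. hinner (H v) (f v) (g v))\<rparr>"

text \<open>The copy of \<open>H v\<close> inside the direct sum.\<close>

definition summand :: "'v set \<Rightarrow> ('v \<Rightarrow> 'a inner_space) \<Rightarrow> 'v \<Rightarrow> ('v \<Rightarrow> 'a) set" where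
  "summand V H v = {f \<in> carrier (hilbert_sum V H). \<forall>u\<in>V - {v}. f u = \<zero>\<^bsub>H u\<^esub>}"


section \<open>Quantum walks\<close>

definition quantum_walk ::
  "'v set \<Rightarrow> ('v \<Rightarrow> 'a inner_space) \<Rightarrow> (('v \<Rightarrow> 'a) \<Rightarrow> ('v \<Rightarrow> 'a)) \<Rightarrow> bool" where
  "quantum_walk V H U \<longleftrightarrow>
     countable V \<and> (\<forall>v\<in>V. separable_hilbert_space (H v)) \<and>
     unitary (hilbert_sum V H) (hilbert_sum V H) U"

definition vertex_proj ::
  "'v set \<Rightarrow> ('v \<Rightarrow> 'a inner_space) \<Rightarrow> 'v \<Rightarrow> ('v \<Rightarrow> 'a) \<Rightarrow> ('v \<Rightarrow> 'a)" where
  "vertex_proj V H v = orth_proj (hilbert_sum V H) (summand V H v)"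

definition walk_block ::
  "'v set \<Rightarrow> ('v \<Rightarrow> 'a inner_space) \<Rightarrow> (('v \<Rightarrow> 'a) \<Rightarrow> ('v \<Rightarrow> 'a)) \<Rightarrow>
   'v \<Rightarrow> 'v \<Rightarrow> ('v \<Rightarrow> 'a) \<Rightarrow> ('v \<Rightarrow> 'a)" where
  "walk_block V H U u v = vertex_proj V H u \<circ> U \<circ> vertex_proj V H v"

text \<open>The number of edges from \<open>v\<close> to \<open>u\<close>; note the order of the arguments.\<close>

definition edge_card ::
  "'v set \<Rightarrow> ('v \<Rightarrow> 'a inner_space) \<Rightarrow> (('v \<Rightarrow> 'a) \<Rightarrow> ('v \<Rightarrow> 'a)) \<Rightarrow>
   'v \<Rightarrow> 'v \<Rightarrow> enat" where
  "edge_card V H U u v = rank_op (hilbert_sum V H) (hilbert_sum V H) (walk_block V H U u v)"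

definition walk_edges ::
  "'v set \<Rightarrow> ('v \<Rightarrow> 'a inner_space) \<Rightarrow> (('v \<Rightarrow> 'a) \<Rightarrow> ('v \<Rightarrow> 'a)) \<Rightarrow> ('v \<times> 'v) set" where
  "walk_edges V H U = {(u, v) \<in> V \<times> V. edge_card V H U u v \<noteq> 0}"

definition one_dim_walk ::
  "(int \<Rightarrow> 'a inner_space) \<Rightarrow> ((int \<Rightarrow> 'a) \<Rightarrow> (int \<Rightarrow> 'a)) \<Rightarrow> bool" where
  "one_dim_walk H U \<longleftrightarrow>
     quantum_walk UNIV H U \<and>
     (\<forall>n. hdim (H n) (carrier (H n)) = 2) \<and>
     walk_edges UNIV H U = (\<Union>n. {(n, n + 1), (n + 1, n)}) \<and>
     (\<forall>n. edge_card UNIV H U n (n + 1) = 1 \<and> edge_card UNIV H U (n + 1) n = 1)"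

definition unitary_equivalent ::
  "'v set \<Rightarrow> ('v \<Rightarrow> 'a inner_space) \<Rightarrow> (('v \<Rightarrow> 'a) \<Rightarrow> ('v \<Rightarrow> 'a)) \<Rightarrow>
   'w set \<Rightarrow> ('w \<Rightarrow> 'b inner_space) \<Rightarrow> (('w \<Rightarrow> 'b) \<Rightarrow> ('w \<Rightarrow> 'b)) \<Rightarrow> bool" where
  "unitary_equivalent V\<^sub>1 H\<^sub>1 U\<^sub>1 V\<^sub>2 H\<^sub>2 U\<^sub>2 \<longleftrightarrow>
     (\<exists>W \<phi>. unitary (hilbert_sum V\<^sub>1 H\<^sub>1) (hilbert_sum V\<^sub>2 H\<^sub>2) W \<and>
        bij_betw \<phi> V\<^sub>1 V\<^sub>2 \<and>
        (\<forall>v\<in>V\<^sub>1. W ` summand V\<^sub>1 H\<^sub>1 v = summand V\<^sub>2 H\<^sub>2 (\<phi> v)) \<and>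
        (\<forall>\<psi>\<in>carrier (hilbert_sum V\<^sub>2 H\<^sub>2).
           W (U\<^sub>1 (adjoint_op (hilbert_sum V\<^sub>1 H\<^sub>1) (hilbert_sum V\<^sub>2 H\<^sub>2) W \<psi>)) = U\<^sub>2 \<psi>))"


section \<open>The four classes\<close>

definition C2 :: "(complex^2) inner_space" where
  "C2 = \<lparr>carrier = UNIV, monoid.mult = undefined, one = undefined, zero = 0, add = (+),
         smult = (*s), hinner = (\<lambda>x y. \<Sum>i\<in>UNIV. cnj (x $ i) * y $ i)\<rparr>"

abbreviation "C2_sum \<equiv> hilbert_sum (UNIV :: int set) (\<lambda>_. C2)"

definition mat2 :: "complex \<Rightarrow> complex \<Rightarrow> complex \<Rightarrow> complex \<Rightarrow> complex^2^2" where
  "mat2 a b c d = vector [vector [a, b], vector [c, d]]"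

text \<open>The operator \<open>|m\<rangle>\<langle>n| \<otimes> A\<close>.\<close>

definition ketbra :: "int \<Rightarrow> int \<Rightarrow> complex^2^2 \<Rightarrow> (int \<Rightarrow> complex^2) \<Rightarrow> (int \<Rightarrow> complex^2)" where
  "ketbra m n A \<psi> = (\<lambda>l. if l = m then A *v \<psi> n else 0)"

text \<open>Walks with state spaces \<open>\<complex>\<^sup>2\<close> whose blocks from \<open>n\<close> to \<open>n - 1\<close> and to \<open>n + 1\<close>
  have the shapes \<open>L\<close> and \<open>R\<close>. Operators are compared on the carrier only.\<close>

definition shape_class ::
  "(complex \<Rightarrow> complex \<Rightarrow> complex \<Rightarrow> complex \<Rightarrow> complex^2^2) \<Rightarrow>
   (complex \<Rightarrow> complex \<Rightarrow> complex \<Rightarrow> complex \<Rightarrow> complex^2^2) \<Rightarrow>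
   ((int \<Rightarrow> complex^2) \<Rightarrow> (int \<Rightarrow> complex^2)) set" where
  "shape_class L R = {U. one_dim_walk (\<lambda>_. C2) U \<and>
     (\<exists>a b c d :: int \<Rightarrow> complex. \<forall>n. \<forall>\<psi>\<in>carrier C2_sum.
        walk_block UNIV (\<lambda>_. C2) U (n - 1) n \<psi> =
          ketbra (n - 1) n (L (a n) (b n) (c n) (d n)) \<psi> \<and>
        walk_block UNIV (\<lambda>_. C2) U (n + 1) n \<psi> =
          ketbra (n + 1) n (R (a n) (b n) (c n) (d n)) \<psi>)}"

definition class_C1 :: "((int \<Rightarrow> complex^2) \<Rightarrow> (int \<Rightarrow> complex^2)) set" where
  "class_C1 = shape_class (\<lambda>a b c d. mat2 a b 0 0) (\<lambda>a b c d. mat2 0 0 c d)"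

definition class_C2 :: "((int \<Rightarrow> complex^2) \<Rightarrow> (int \<Rightarrow> complex^2)) set" where
  "class_C2 = shape_class (\<lambda>a b c d. mat2 a 0 c 0) (\<lambda>a b c d. mat2 0 b 0 d)"

definition class_C3 :: "((int \<Rightarrow> complex^2) \<Rightarrow> (int \<Rightarrow> complex^2)) set" where
  "class_C3 = shape_class (\<lambda>a b c d. mat2 0 0 c d) (\<lambda>a b c d. mat2 a b 0 0)"

definition class_C4 :: "((int \<Rightarrow> complex^2) \<Rightarrow> (int \<Rightarrow> complex^2)) set" where
  "class_C4 = shape_class (\<lambda>a b c d. mat2 0 b 0 d) (\<lambda>a b c d. mat2 a 0 c 0)"

end

theory Submission
  imports Defs
begin

text \<open>
  Write \<open>B m n\<close> for the block of \<open>U\<close> from \<open>H n\<close> to \<open>H m\<close>; only \<open>B (n - 1) n\<close> and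
  \<open>B (n + 1) n\<close> are nonzero and both have rank one. The images of \<open>H (n - 1)\<close> and
  \<open>H (n + 1)\<close> under \<open>U\<close> are orthogonal and meet only over \<open>n\<close>, so the ranges of \<open>B n (n - 1)\<close> and
  \<open>B n (n + 1)\<close> are orthogonal lines of the plane \<open>H n\<close>. Likewise \<open>U\<close> maps the kernels of
  \<open>B (n - 1) n\<close> and \<open>B (n + 1) n\<close> to vectors living over \<open>n + 1\<close> and over \<open>n - 1\<close>, so these kernels are
  orthogonal lines as well. Taking the two ranges as coordinate axes of \<open>H n\<close> makes a row of each
  block vanish, which gives \<open>C\<^sub>1\<close> and \<open>C\<^sub>3\<close>; taking the two kernels makes a column vanish,
  which gives \<open>C\<^sub>2\<close> and \<open>C\<^sub>4\<close>.
\<close>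

section \<open>Complex inner product spaces\<close>

text \<open>The linear structure alone, kept apart from positivity and completeness, so that facts
  on spans, dimension and rank apply to the direct sum once its module axioms are checked.\<close>

locale complex_module =
  module "ring_of_type_algebra :: complex ring" H for H :: "'a inner_space" (structure)
begin

text \<open>The inherited module laws speak about the record \<open>ring_of_type_algebra\<close>;
  here they are translated to the arithmetic of the type \<open>complex\<close>.\<close>

lemma
  shows smult_carrier [simp, intro]: "x \<in> carrier H \<Longrightarrow> a \<odot> x \<in> carrier H"
    and smult_add_left: "x \<in> carrier H \<Longrightarrow> (a + b) \<odot> x = a \<odot> x \<oplus> b \<odot> x"
    and smult_add_right:
      "\<lbrakk>x \<in> carrier H; y \<in> carrier H\<rbrakk> \<Longrightarrow> a \<odot> (x \<oplus> y) = a \<odot> x \<oplus> a \<odot> y"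
    and smult_smult: "x \<in> carrier H \<Longrightarrow> a \<odot> (b \<odot> x) = (a * b) \<odot> x"
    and one_smult [simp]: "x \<in> carrier H \<Longrightarrow> 1 \<odot> x = x"
    and zero_smult [simp]: "x \<in> carrier H \<Longrightarrow> 0 \<odot> x = \<zero>"
    and smult_zero [simp]: "a \<odot> \<zero> = \<zero>"
    and neg_one_smult: "x \<in> carrier H \<Longrightarrow> (- 1) \<odot> x = \<ominus> x"
proof -
  have R: "carrier (ring_of_type_algebra :: complex ring) = UNIV"
    "add (ring_of_type_algebra :: complex ring) = (+)"
    "monoid.mult (ring_of_type_algebra :: complex ring) = (*)"
    "one (ring_of_type_algebra :: complex ring) = 1"
    "zero (ring_of_type_algebra :: complex ring) = 0"
    by (simp_all add: ring_of_type_algebra_def)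
  show "x \<in> carrier H \<Longrightarrow> a \<odot> x \<in> carrier H"
    using smult_closed[of a x] by (simp add: R)
  show "x \<in> carrier H \<Longrightarrow> (a + b) \<odot> x = a \<odot> x \<oplus> b \<odot> x"
    using smult_l_distr[of a b x] by (simp add: R)
  show "\<lbrakk>x \<in> carrier H; y \<in> carrier H\<rbrakk> \<Longrightarrow> a \<odot> (x \<oplus> y) = a \<odot> x \<oplus> a \<odot> y"
    using smult_r_distr[of a x y] by (simp add: R)
  show "x \<in> carrier H \<Longrightarrow> a \<odot> (b \<odot> x) = (a * b) \<odot> x"
    using smult_assoc1[of a b x] by (simp add: R)
  show "x \<in> carrier H \<Longrightarrow> 1 \<odot> x = x"
    using smult_one[of x] by (simp add: R)
  show zero: "x \<in> carrier H \<Longrightarrow> 0 \<odot> x = \<zero>" for x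
    using smult_l_null[of x] by (simp add: R)
  show "a \<odot> \<zero> = \<zero>"
    using smult_r_null[of a] by (simp add: R)
  assume x: "x \<in> carrier H"
  have "x \<oplus> (- 1) \<odot> x = (1 + - 1) \<odot> x"
    using smult_l_distr[of 1 "- 1" x] smult_one[of x] x by (simp add: R)
  then have "(- 1) \<odot> x \<oplus> x = \<zero>"
    using zero x smult_closed[of "- 1" x] by (simp add: R a_comm)
  then show "(- 1) \<odot> x = \<ominus> x"
    using x smult_closed[of "- 1" x] by (simp add: R minus_equality)
qed

lemma lincomb_empty [simp]: "lincomb H c {} = \<zero>"
  by (simp add: lincomb_def)

lemma lincomb_singleton:
  "x \<in> carrier H \<Longrightarrow> lincomb H c {x} = c x \<odot> x"
  by (simp add: lincomb_def)

lemma lincomb_pair: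
  "\<lbrakk>x \<in> carrier H; y \<in> carrier H; x \<noteq> y\<rbrakk> \<Longrightarrow> lincomb H c {x, y} = c x \<odot> x \<oplus> c y \<odot> y"
  by (simp add: lincomb_def)

end

text \<open>Additive inverses are not among the premises because \<open>(- 1) \<odot> x\<close> is
  one, by distributivity and the law for \<open>0 \<odot> x\<close>.\<close>

lemma complex_moduleI:
  fixes H :: "'a inner_space" (structure)
  assumes "\<And>x y. \<lbrakk>x \<in> carrier H; y \<in> carrier H\<rbrakk> \<Longrightarrow> x \<oplus> y \<in> carrier H"
    and "\<zero> \<in> carrier H"
    and "\<And>x y z. \<lbrakk>x \<in> carrier H; y \<in> carrier H; z \<in> carrier H\<rbrakk> \<Longrightarrow>
      (x \<oplus> y) \<oplus> z = x \<oplus> (y \<oplus> z)"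
    and "\<And>x y. \<lbrakk>x \<in> carrier H; y \<in> carrier H\<rbrakk> \<Longrightarrow> x \<oplus> y = y \<oplus> x"
    and "\<And>x. x \<in> carrier H \<Longrightarrow> \<zero> \<oplus> x = x"
    and "\<And>x. x \<in> carrier H \<Longrightarrow> 0 \<odot> x = \<zero>"
    and "\<And>a x. x \<in> carrier H \<Longrightarrow> a \<odot> x \<in> carrier H"
    and "\<And>a b x. x \<in> carrier H \<Longrightarrow> (a + b) \<odot> x = a \<odot> x \<oplus> b \<odot> x"
    and "\<And>a x y. \<lbrakk>x \<in> carrier H; y \<in> carrier H\<rbrakk> \<Longrightarrow> a \<odot> (x \<oplus> y) = a \<odot> x \<oplus> a \<odot> y"
    and "\<And>a b x. x \<in> carrier H \<Longrightarrow> (a * b) \<odot> x = a \<odot> (b \<odot> x)"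
    and "\<And>x. x \<in> carrier H \<Longrightarrow> 1 \<odot> x = x"
  shows "complex_module H"
proof -
  have "abelian_group H"
  proof (rule abelian_groupI)
    fix x assume x: "x \<in> carrier H"
    have "(- 1) \<odot> x \<oplus> x = (- 1 + 1) \<odot> x"
      using assms(8)[of x "- 1" 1] assms(11)[OF x] x by simp
    then show "\<exists>y\<in>carrier H. y \<oplus> x = \<zero>"
      using assms(6,7) x by auto
  qed (use assms in auto)
  then have "module (ring_of_type_algebra :: complex ring) H"
    by (intro moduleI cring_from_type_algebra)
      (use assms in \<open>auto simp: ring_of_type_algebra_def\<close>)
  then show ?thesis
    by (simp add: complex_module_def)
qed

sublocale hilbert_space \<subseteq> complex_module
  by unfold_locales

section \<open>Inner product and norm\<close>

context hilbert_space
begin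

lemma hinner_add_left:
  "\<lbrakk>x \<in> carrier H; y \<in> carrier H; z \<in> carrier H\<rbrakk> \<Longrightarrow>
    hinner H (x \<oplus> y) z = hinner H x z + hinner H y z"
  using hinner_commute[of z "x \<oplus> y"] hinner_commute[of z x] hinner_commute[of z y]
  by (simp add: hinner_add_right)

lemma hinner_smult_left:
  "\<lbrakk>x \<in> carrier H; y \<in> carrier H\<rbrakk> \<Longrightarrow> hinner H (a \<odot> x) y = cnj a * hinner H x y"
  using hinner_commute[of y "a \<odot> x"] hinner_commute[of y x] by (simp add: hinner_smult_right)

lemma hinner_zero_right [simp]: "x \<in> carrier H \<Longrightarrow> hinner H x \<zero> = 0"
  using hinner_smult_right[of x \<zero> 0] by simp

lemma hinner_zero_left [simp]: "x \<in> carrier H \<Longrightarrow> hinner H \<zero> x = 0"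
  using hinner_smult_left[of \<zero> x 0] by simp

lemma hnorm_zero [simp]: "hnorm H \<zero> = 0"
  by (simp add: hnorm_def)

lemma Re_hinner_nonneg: "x \<in> carrier H \<Longrightarrow> Re (hinner H x x) \<ge> 0"
  using hinner_pos[of x] by (cases "x = \<zero>") auto

lemma hnorm_square: "x \<in> carrier H \<Longrightarrow> (hnorm H x)\<^sup>2 = Re (hinner H x x)"
  by (simp add: hnorm_def Re_hinner_nonneg)

lemma hinner_self: "x \<in> carrier H \<Longrightarrow> hinner H x x = of_real ((hnorm H x)\<^sup>2)"
  using hinner_commute[of x x] by (simp add: hnorm_square complex_eq_iff)

lemma hnorm_pos: "\<lbrakk>x \<in> carrier H; x \<noteq> \<zero>\<rbrakk> \<Longrightarrow> hnorm H x > 0"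
  using hinner_pos by (simp add: hnorm_def)

lemma hnorm_smult_square:
  assumes "x \<in> carrier H"
  shows "(hnorm H (a \<odot> x))\<^sup>2 = (cmod a)\<^sup>2 * (hnorm H x)\<^sup>2"
proof -
  have "hinner H (a \<odot> x) (a \<odot> x) = a * cnj a * of_real ((hnorm H x)\<^sup>2)"
    using assms by (simp add: hinner_smult_left hinner_smult_right hinner_self[of x])
  then have "of_real ((hnorm H (a \<odot> x))\<^sup>2) = (of_real ((cmod a)\<^sup>2 * (hnorm H x)\<^sup>2) :: complex)"
    using assms hinner_self[of "a \<odot> x"] by (simp only: of_real_mult complex_norm_square smult_carrier)
  then show ?thesis
    by (simp only: of_real_eq_iff)
qed

text \<open>By the parallelogram law the two sides differ by the squared norm of the difference of
  \<open>x\<close> and \<open>y\<close>. The bound makes square summability pass to sums.\<close>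

lemma hnorm_add_square_le:
  assumes x: "x \<in> carrier H" and y: "y \<in> carrier H"
  shows "(hnorm H (x \<oplus> y))\<^sup>2 \<le> 2 * (hnorm H x)\<^sup>2 + 2 * (hnorm H y)\<^sup>2"
proof -
  have "0 \<le> Re (hinner H (x \<oplus> (- 1) \<odot> y) (x \<oplus> (- 1) \<odot> y))"
    using x y by (intro Re_hinner_nonneg) auto
  then show ?thesis
    using x y by (simp add: hnorm_square hinner_add_left hinner_add_right hinner_smult_left
        hinner_smult_right)
qed

text \<open>Nondegeneracy, by testing against the difference of \<open>x\<close> and
  \<open>y\<close>. It gives uniqueness wherever a vector is specified by its inner products, as in
  projections and adjoints.\<close>

lemma hinner_ext:
  assumes x: "x \<in> carrier H" and y: "y \<in> carrier H"
    and eq: "\<And>z. z \<in> carrier H \<Longrightarrow> hinner H z x = hinner H z y"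
  shows "x = y"
proof -
  let ?d = "x \<oplus> (- 1) \<odot> y"
  have "hinner H ?d ?d = 0"
    using x y eq[of ?d] by (simp add: hinner_add_right hinner_smult_right)
  then have "x \<ominus> y = \<zero>"
    using hinner_pos[of ?d] x y by (auto simp: neg_one_smult minus_eq)
  then show ?thesis
    using x y by (simp add: minus_eq r_neg minus_equality) (metis r_neg2 r_zero a_inv_closed a_comm l_zero)
qed

end

section \<open>Unitary maps\<close>

lemma
  assumes "unitary H K W"
  shows unitary_bij: "bij_betw W (carrier H) (carrier K)"
    and unitary_carrier [intro]: "x \<in> carrier H \<Longrightarrow> W x \<in> carrier K"
    and unitary_add:
      "\<lbrakk>x \<in> carrier H; y \<in> carrier H\<rbrakk> \<Longrightarrow> W (x \<oplus>\<^bsub>H\<^esub> y) = W x \<oplus>\<^bsub>K\<^esub> W y"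
    and unitary_smult: "x \<in> carrier H \<Longrightarrow> W (a \<odot>\<^bsub>H\<^esub> x) = a \<odot>\<^bsub>K\<^esub> W x"
    and unitary_hinner:
      "\<lbrakk>x \<in> carrier H; y \<in> carrier H\<rbrakk> \<Longrightarrow> hinner K (W x) (W y) = hinner H x y"
    and unitary_inv_right: "z \<in> carrier K \<Longrightarrow> W (inv_into (carrier H) W z) = z"
    and unitary_inv_left: "x \<in> carrier H \<Longrightarrow> inv_into (carrier H) W (W x) = x"
    and unitary_inv_carrier: "z \<in> carrier K \<Longrightarrow> inv_into (carrier H) W z \<in> carrier H"
  using assms unfolding unitary_def
  by (auto simp: bij_betw_inv_into_right bij_betw_inv_into_left bij_betwE
      intro: bij_betwE[OF bij_betw_inv_into, rule_format])

lemma unitary_zero: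
  assumes "unitary H K W" "complex_module H" "complex_module K"
  shows "W \<zero>\<^bsub>H\<^esub> = \<zero>\<^bsub>K\<^esub>"
proof -
  interpret H: complex_module H by fact
  interpret K: complex_module K by fact
  have "W (0 \<odot>\<^bsub>H\<^esub> \<zero>\<^bsub>H\<^esub>) = 0 \<odot>\<^bsub>K\<^esub> W \<zero>\<^bsub>H\<^esub>"
    by (rule unitary_smult[OF assms(1)]) simp
  then show ?thesis
    using unitary_carrier[OF assms(1), of "\<zero>\<^bsub>H\<^esub>"] by simp
qed

lemma unitary_eq_zero_iff:
  assumes "unitary H K W" "complex_module H" "complex_module K" "x \<in> carrier H"
  shows "W x = \<zero>\<^bsub>K\<^esub> \<longleftrightarrow> x = \<zero>\<^bsub>H\<^esub>"
proof -
  interpret H: complex_module H by fact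
  show ?thesis
    using unitary_inv_left[OF assms(1,4)] unitary_inv_left[OF assms(1) H.zero_closed]
      unitary_zero[OF assms(1-3)] by metis
qed

lemma unitary_comp:
  assumes "unitary H K V" "unitary K L W"
  shows "unitary H L (\<lambda>x. W (V x))"
  using assms unitary_carrier[OF assms(1)] bij_betw_trans[of V "carrier H" "carrier K" W "carrier L"]
  unfolding unitary_def by (simp add: comp_def)

lemma unitary_inv:
  assumes W: "unitary H K W" and "complex_module H"
  shows "unitary K H (inv_into (carrier H) W)"
proof -
  interpret complex_module H by fact
  let ?V = "inv_into (carrier H) W"
  have V: "?V (W x) = x" if "x \<in> carrier H" for x
    using unitary_inv_left[OF W that] .
  have ex: "\<exists>x\<in>carrier H. y = W x" if "y \<in> carrier K" for y
    using unitary_inv_right[OF W that] unitary_inv_carrier[OF W that] by metis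
  show ?thesis
    unfolding unitary_def
  proof (intro conjI ballI allI)
    show "bij_betw ?V (carrier K) (carrier H)"
      by (rule bij_betw_inv_into[OF unitary_bij[OF W]])
  next
    fix y z assume "y \<in> carrier K" "z \<in> carrier K"
    then obtain x x' where x: "x \<in> carrier H" "y = W x" "x' \<in> carrier H" "z = W x'"
      using ex by metis
    then show "?V (y \<oplus>\<^bsub>K\<^esub> z) = ?V y \<oplus>\<^bsub>H\<^esub> ?V z"
      using V[of "x \<oplus>\<^bsub>H\<^esub> x'"] by (simp add: V unitary_add[OF W])
    show "hinner H (?V y) (?V z) = hinner K y z"
      using x by (simp add: V unitary_hinner[OF W])
  next
    fix a y assume "y \<in> carrier K"
    then obtain x where x: "x \<in> carrier H" "y = W x"
      using ex by metis
    then show "?V (a \<odot>\<^bsub>K\<^esub> y) = a \<odot>\<^bsub>H\<^esub> ?V y"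
      using V[of "a \<odot>\<^bsub>H\<^esub> x"] by (simp add: V unitary_smult[OF W])
  qed
qed

text \<open>Coefficients are functions of the vectors themselves, so they have to be pulled back
  along \<open>W\<close>. Injectivity of \<open>W\<close> ensures that no two terms merge in the
  image.\<close>

lemma unitary_lincomb:
  assumes W: "unitary H K W" and "complex_module H" "complex_module K"
    and A: "finite A" "A \<subseteq> carrier H"
  shows "W (lincomb H (\<lambda>x. c (W x)) A) = lincomb K c (W ` A)"
proof -
  interpret H: complex_module H by fact
  interpret K: complex_module K by fact
  note Wc = unitary_carrier[OF W]
  show ?thesis
    using A
  proof (induction A rule: finite_induct)
    case empty
    then show ?case
      by (simp add: unitary_zero[OF assms(1-3)])
  next
    case (insert x A)
    have "W x \<notin> W ` A"
      using insert unitary_inv_left[OF W] by (metis image_iff insert_subset subsetD)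
    moreover have "(\<lambda>x. c (W x) \<odot>\<^bsub>H\<^esub> x) \<in> A \<rightarrow> carrier H"
      "(\<lambda>y. c y \<odot>\<^bsub>K\<^esub> y) \<in> W ` A \<rightarrow> carrier K"
      using insert.prems Wc by (auto intro!: H.smult_carrier K.smult_carrier)
    moreover have "finsum H (\<lambda>x. c (W x) \<odot>\<^bsub>H\<^esub> x) A \<in> carrier H"
      using calculation(2) by (rule H.finsum_closed)
    ultimately show ?case
      using insert Wc
      by (simp add: lincomb_def H.finsum_insert K.finsum_insert unitary_add[OF W]
          unitary_smult[OF W])
  qed
qed

lemma hdim_unitary_image_le:
  assumes W: "unitary H K W" and "complex_module H" "complex_module K" and S: "S \<subseteq> carrier H"
  shows "hdim K (W ` S) \<le> hdim H S"
  unfolding hdim_def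
proof (rule Inf_greatest, clarify)
  fix B assume fin: "finite B" and "lin_basis H S B"
  then have B: "B \<subseteq> S" "lin_indep H B" "lin_span H B = S"
    by (auto simp: lin_basis_def)
  have inj: "inj_on W (carrier H)"
    using unitary_bij[OF W] by (rule bij_betw_imp_inj_on)
  note lc = unitary_lincomb[OF assms(1-3)]
  have sub: "A \<subseteq> carrier H" if "A \<subseteq> B" for A
    using that B(1) S by auto
  have pull: "\<exists>A'\<subseteq>B. A = W ` A' \<and> finite A'" if "A \<subseteq> W ` B" for A
    using that fin finite_subset by (metis subset_imageE)
  have "lin_indep K (W ` B)"
    unfolding lin_indep_def
  proof (intro allI impI ballI)
    fix A c y
    assume A: "finite A \<and> A \<subseteq> W ` B \<and> lincomb K c A = \<zero>\<^bsub>K\<^esub>" and y: "y \<in> A"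
    then obtain A' where A': "A' \<subseteq> B" "A = W ` A'" "finite A'"
      using pull by blast
    interpret H: complex_module H by fact
    have "lincomb H (\<lambda>x. c (W x)) A' \<in> carrier H"
      unfolding lincomb_def using sub[OF A'(1)] by (intro H.finsum_closed) auto
    moreover have "W (lincomb H (\<lambda>x. c (W x)) A') = \<zero>\<^bsub>K\<^esub>"
      using lc[OF A'(3) sub[OF A'(1)], of c] A A'(2) by simp
    ultimately have "lincomb H (\<lambda>x. c (W x)) A' = \<zero>\<^bsub>H\<^esub>"
      using unitary_eq_zero_iff[OF assms(1-3)] by blast
    then have "\<forall>x\<in>A'. c (W x) = 0"
      using B(2) A' unfolding lin_indep_def by (auto dest!: spec2[where x = A'])
    then show "c y = 0"
      using y A'(2) by auto
  qed
  moreover have "lin_span K (W ` B) = W ` S"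
  proof (intro equalityI subsetI)
    fix y assume "y \<in> lin_span K (W ` B)"
    then obtain A c where A: "y = lincomb K c A" "A \<subseteq> W ` B"
      by (auto simp: lin_span_def)
    then obtain A' where A': "A' \<subseteq> B" "A = W ` A'" "finite A'"
      using pull by blast
    then have "y = W (lincomb H (\<lambda>x. c (W x)) A')"
      using A lc[OF A'(3) sub[OF A'(1)], of c] by simp
    moreover have "lincomb H (\<lambda>x. c (W x)) A' \<in> S"
      using A' B(3) by (auto simp: lin_span_def)
    ultimately show "y \<in> W ` S"
      by blast
  next
    fix y assume "y \<in> W ` S"
    then obtain c A where A: "y = W (lincomb H c A)" "finite A" "A \<subseteq> B"
      using B(3) by (auto simp: lin_span_def)
    \<comment> \<open>The transport rule expects coefficients that depend on \<open>W x\<close>;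
      composing with the inverse of \<open>W\<close> brings \<open>c\<close> into this form.\<close>
    have "lincomb H c A = lincomb H (\<lambda>x. c (inv_into (carrier H) W (W x))) A"
      unfolding lincomb_def
    proof (intro abelian_monoid.finsum_cong')
      show "abelian_monoid H"
        using assms(2) by (simp add: complex_module_def module_def abelian_group_def)
      show "(\<lambda>x. c (inv_into (carrier H) W (W x)) \<odot>\<^bsub>H\<^esub> x) \<in> A \<rightarrow> carrier H"
        using sub[OF A(3)] complex_module.smult_carrier[OF assms(2)] by auto
      show "\<And>x. x \<in> A \<Longrightarrow> c x \<odot>\<^bsub>H\<^esub> x = c (inv_into (carrier H) W (W x)) \<odot>\<^bsub>H\<^esub> x"
        using sub[OF A(3)] unitary_inv_left[OF W] by auto
    qed simp
    then have "y = lincomb K (\<lambda>z. c (inv_into (carrier H) W z)) (W ` A)"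
      using A(1) lc[OF A(2) sub[OF A(3)]] by simp
    then show "y \<in> lin_span K (W ` B)"
      using A by (auto simp: lin_span_def)
  qed
  ultimately have "lin_basis K (W ` S) (W ` B)"
    using B(1) by (auto simp: lin_basis_def)
  moreover have "card (W ` B) = card B"
    using sub[of B] inj by (meson card_image inj_on_subset order_refl)
  ultimately show "Inf {enat (card B) |B. finite B \<and> lin_basis K (W ` S) B} \<le> enat (card B)"
    using fin by (intro Inf_lower) (auto intro!: exI[of _ "W ` B"])
qed

text \<open>The reverse inequality is the previous one for the inverse of \<open>W\<close>.\<close>

lemma hdim_unitary_image:
  assumes W: "unitary H K W" and mod: "complex_module H" "complex_module K"
    and S: "S \<subseteq> carrier H"
  shows "hdim K (W ` S) = hdim H S"
proof (rule antisym)
  let ?V = "inv_into (carrier H) W"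
  have "?V ` (W ` S) = S"
    using S by (auto simp: image_image unitary_inv_left[OF W] subset_iff image_iff)
  moreover have "hdim H (?V ` (W ` S)) \<le> hdim K (W ` S)"
    using S unitary_carrier[OF W] by (intro hdim_unitary_image_le unitary_inv W mod) auto
  ultimately show "hdim H S \<le> hdim K (W ` S)"
    by simp
qed (rule hdim_unitary_image_le[OF assms])

text \<open>Preservation of the inner product shows that the inverse satisfies the defining equation
  of the adjoint. Nondegeneracy, which makes the definite description unique, enters as the premise
  \<open>ext\<close>; for the direct sum it is proved componentwise.\<close>

lemma adjoint_op_unitary:
  assumes W: "unitary H K W" and y: "y \<in> carrier K"
    and ext: "\<And>x x'. \<lbrakk>x \<in> carrier H; x' \<in> carrier H;
      \<And>z. z \<in> carrier H \<Longrightarrow> hinner H z x = hinner H z x'\<rbrakk> \<Longrightarrow> x = x'"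
  shows "adjoint_op H K W y = inv_into (carrier H) W y"
proof -
  let ?x = "inv_into (carrier H) W y"
  have "?x \<in> carrier H" "hinner K (W z) y = hinner H z ?x" if "z \<in> carrier H" for z
    using unitary_inv_right[OF W y] unitary_inv_carrier[OF W y] unitary_hinner[OF W that, of ?x]
    by auto
  then show ?thesis
    unfolding adjoint_op_def
    using unitary_inv_carrier[OF W y] by (intro the_equality) (auto intro: ext)
qed

text \<open>Injectivity comes from \<open>hinner\<close> and \<open>ext\<close>: vectors with the
  same image have the same inner products with all vectors.\<close>

lemma unitaryI:
  assumes W: "\<And>x. x \<in> carrier H \<Longrightarrow> W x \<in> carrier K"
    and surj: "\<And>y. y \<in> carrier K \<Longrightarrow> \<exists>x\<in>carrier H. W x = y"
    and add: "\<And>x y. \<lbrakk>x \<in> carrier H; y \<in> carrier H\<rbrakk> \<Longrightarrow> W (x \<oplus>\<^bsub>H\<^esub> y) = W x \<oplus>\<^bsub>K\<^esub> W y"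
    and smult: "\<And>a x. x \<in> carrier H \<Longrightarrow> W (a \<odot>\<^bsub>H\<^esub> x) = a \<odot>\<^bsub>K\<^esub> W x"
    and hinner: "\<And>x y. \<lbrakk>x \<in> carrier H; y \<in> carrier H\<rbrakk> \<Longrightarrow> hinner K (W x) (W y) = hinner H x y"
    and ext: "\<And>x x'. \<lbrakk>x \<in> carrier H; x' \<in> carrier H;
      \<And>z. z \<in> carrier H \<Longrightarrow> hinner H z x = hinner H z x'\<rbrakk> \<Longrightarrow> x = x'"
  shows "unitary H K W"
proof -
  have "inj_on W (carrier H)"
  proof (rule inj_onI)
    fix x x' assume "x \<in> carrier H" "x' \<in> carrier H" "W x = W x'"
    then show "x = x'"
      by (intro ext) (metis hinner)+
  qed
  moreover have "W ` carrier H = carrier K"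
    using W surj by (auto simp: image_iff)
  ultimately show ?thesis
    using add smult hinner by (simp add: unitary_def bij_betw_def)
qed

section \<open>Dimensions zero, one and two\<close>

text \<open>The naturals are well ordered, so a finite infimum is attained. This produces a basis of
  the given size without comparing different bases.\<close>

lemma hdim_eq_enatD:
  assumes "hdim H S = enat n"
  obtains B where "finite B" "card B = n" "lin_basis H S B"
proof -
  define D where "D = {enat (card B) |B. finite B \<and> lin_basis H S B}"
  have Inf: "Inf D = enat n"
    using assms by (simp add: hdim_def D_def)
  then obtain k where "k \<in> D"
    by (auto simp: Inf_enat_def split: if_splits)
  then have "Inf D \<in> D"
    using LeastI[of "\<lambda>x. x \<in> D" k] by (auto simp: Inf_enat_def)
  then show ?thesis
    using Inf that by (auto simp: D_def)
qed

context complex_module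
begin

lemma hdim_zeroD:
  assumes "hdim H S = 0"
  shows "S = {\<zero>}"
proof -
  obtain B where "finite B" "card B = 0" "lin_basis H S B"
    using hdim_eq_enatD[of H S 0] assms by (auto simp: zero_enat_def)
  then show ?thesis
    by (auto simp: lin_basis_def lin_span_def)
qed

lemma hdim_oneD:
  assumes "hdim H S = 1" "S \<subseteq> carrier H"
  obtains r where "r \<in> carrier H" "r \<noteq> \<zero>" "S = range (\<lambda>c. c \<odot> r)"
proof -
  obtain B where "card B = 1" and B: "lin_basis H S B"
    using hdim_eq_enatD[of H S 1] assms by (auto simp: one_enat_def)
  then obtain r where r: "B = {r}"
    by (auto simp: card_1_singleton_iff)
  then have rc: "r \<in> carrier H" "lin_indep H {r}" "S = lin_span H {r}"
    using B assms(2) by (auto simp: lin_basis_def)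
  have "\<not> lincomb H (\<lambda>_. 1) {r} = \<zero>"
    using rc(2) by (auto simp: lin_indep_def dest!: spec2[where x = "{r}"])
  then have "r \<noteq> \<zero>"
    by (simp add: lincomb_singleton rc(1))
  moreover have "S = range (\<lambda>c. c \<odot> r)"
  proof (intro equalityI subsetI)
    fix y assume "y \<in> S"
    then obtain c A where A: "y = lincomb H c A" "A \<subseteq> {r}"
      using rc(3) by (auto simp: lin_span_def)
    then consider "A = {}" | "A = {r}"
      by blast
    then show "y \<in> range (\<lambda>c. c \<odot> r)"
    proof cases
      case 1
      then show ?thesis using A(1) zero_smult[OF rc(1)] by (metis lincomb_empty rangeI)
    next
      case 2
      then show ?thesis using A(1) rc(1) by (simp add: lincomb_singleton)
    qed
  next
    fix y assume "y \<in> range (\<lambda>c. c \<odot> r)"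
    then obtain c where "y = lincomb H (\<lambda>_. c) {r}"
      using rc(1) by (auto simp: lincomb_singleton)
    then show "y \<in> S"
      unfolding rc(3) lin_span_def by blast
  qed
  ultimately show ?thesis
    using that rc(1) by blast
qed

lemma hdim_twoD:
  assumes "hdim H (carrier H) = 2"
  obtains x y where "x \<in> carrier H" "y \<in> carrier H"
    "\<And>a b. a \<odot> x \<oplus> b \<odot> y = \<zero> \<Longrightarrow> a = 0 \<and> b = 0"
    "\<And>z. z \<in> carrier H \<Longrightarrow> \<exists>a b. z = a \<odot> x \<oplus> b \<odot> y"
proof -
  obtain B where "card B = 2" and B: "lin_basis H (carrier H) B"
    using hdim_eq_enatD[of H "carrier H" 2] assms by (auto simp: numeral_eq_enat)
  then obtain x y where xy: "B = {x, y}" "x \<noteq> y"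
    by (auto simp: card_2_iff)
  then have c: "x \<in> carrier H" "y \<in> carrier H" "lin_indep H {x, y}"
    "carrier H = lin_span H {x, y}"
    using B by (auto simp: lin_basis_def)
  have "a = 0 \<and> b = 0" if "a \<odot> x \<oplus> b \<odot> y = \<zero>" for a b
  proof -
    \<comment> \<open>Since \<open>x\<close> and \<open>y\<close> differ, one function of the vector
      can carry both scalars.\<close>
    let ?c = "\<lambda>z. if z = x then a else b"
    have "lincomb H ?c {x, y} = \<zero>"
      using that xy(2) c(1,2) by (simp add: lincomb_pair)
    then have "\<forall>z\<in>{x, y}. ?c z = 0"
      using c(3) by (simp only: lin_indep_def) (erule allE[of _ "{x, y}"], erule allE[of _ ?c], simp)
    then show ?thesis
      using xy(2) by auto
  qed
  moreover have "\<exists>a b. z = a \<odot> x \<oplus> b \<odot> y" if "z \<in> carrier H" for z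
  proof -
    have "z \<in> lin_span H {x, y}"
      using that c(4) by blast
    then obtain k A where A: "z = lincomb H k A" "A \<subseteq> {x, y}"
      by (auto simp: lin_span_def)
    have "A = {} \<or> A = {x} \<or> A = {y} \<or> A = {x, y}"
      using A(2) by blast
    then consider "A = {}" | "A = {x}" | "A = {y}" | "A = {x, y}"
      by metis
    then show ?thesis
    proof cases
      case 1
      then show ?thesis
        using A(1) c(1,2) by (intro exI[of _ 0]) simp
    next
      case 2
      then show ?thesis
        using A(1) c(1,2) by (intro exI[of _ "k x"] exI[of _ 0]) (simp add: lincomb_singleton)
    next
      case 3
      then show ?thesis
        using A(1) c(1,2) by (intro exI[of _ 0] exI[of _ "k y"]) (simp add: lincomb_singleton)
    next
      case 4
      then show ?thesis
        using A(1) c(1,2) xy(2) by (auto simp: lincomb_pair)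
    qed
  qed
  ultimately show ?thesis
    using that c(1,2) by blast
qed

text \<open>Rank and nullity for a map of rank at most one on a plane. It will be applied to the
  blocks of the walk.\<close>

lemma ex_nonzero_kernel:
  assumes "hdim H (carrier H) = 2" "complex_module K"
    and add: "\<And>x y. \<lbrakk>x \<in> carrier H; y \<in> carrier H\<rbrakk> \<Longrightarrow> f (x \<oplus> y) = f x \<oplus>\<^bsub>K\<^esub> f y"
    and smult: "\<And>a x. x \<in> carrier H \<Longrightarrow> f (a \<odot> x) = a \<odot>\<^bsub>K\<^esub> f x"
    and range: "f ` carrier H \<subseteq> range (\<lambda>c. c \<odot>\<^bsub>K\<^esub> r)" and r: "r \<in> carrier K"
  obtains s where "s \<in> carrier H" "s \<noteq> \<zero>" "f s = \<zero>\<^bsub>K\<^esub>"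
proof -
  interpret K: complex_module K by fact
  obtain x y where xy: "x \<in> carrier H" "y \<in> carrier H"
    and indep: "\<And>a b. a \<odot> x \<oplus> b \<odot> y = \<zero> \<Longrightarrow> a = 0 \<and> b = 0"
    using hdim_twoD[OF assms(1)] by metis
  obtain a b where ab: "f x = a \<odot>\<^bsub>K\<^esub> r" "f y = b \<odot>\<^bsub>K\<^esub> r"
    using range xy by (metis image_subset_iff rangeE)
  \<comment> \<open>If \<open>f x\<close> and \<open>f y\<close> are \<open>a\<close> and
    \<open>b\<close> times \<open>r\<close>, then \<open>f\<close> kills \<open>b\<close> times
    \<open>x\<close> minus \<open>a\<close> times \<open>y\<close>, which is nonzero by independence
    when \<open>a\<close> is nonzero. When \<open>a\<close> is zero, \<open>x\<close> itself is
    killed.\<close>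
  define s where "s = (if a = 0 then x else b \<odot> x \<oplus> (- a) \<odot> y)"
  have "x \<noteq> \<zero>"
    using indep[of 1 0] xy by auto
  then have "s \<noteq> \<zero>"
    using indep[of b "- a"] by (auto simp: s_def)
  moreover have "s \<in> carrier H"
    using xy by (simp add: s_def)
  moreover have "f s = \<zero>\<^bsub>K\<^esub>"
    using xy r by (auto simp: s_def add smult ab K.smult_smult simp flip: K.smult_add_left)
  ultimately show ?thesis
    using that by blast
qed

end

section \<open>Hilbert sums\<close>

text \<open>The restriction to \<open>V\<close> leaves the value \<open>undefined\<close> elsewhere,
  as membership in the extensional product demands.\<close>

definition emb :: "'v set \<Rightarrow> ('v \<Rightarrow> 'a inner_space) \<Rightarrow> 'v \<Rightarrow> 'a \<Rightarrow> 'v \<Rightarrow> 'a" where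
  "emb V H v x = (\<lambda>u\<in>V. if u = v then x else \<zero>\<^bsub>H u\<^esub>)"

locale hilbert_family =
  fixes V :: "'v set" and H :: "'v \<Rightarrow> 'a inner_space"
  assumes hilbert: "v \<in> V \<Longrightarrow> hilbert_space (H v)"
begin

abbreviation "S \<equiv> hilbert_sum V H"

lemma module_summand: "v \<in> V \<Longrightarrow> complex_module (H v)"
  using hilbert by (simp add: hilbert_space.axioms complex_module_def)

lemma zero_H [simp, intro]: "v \<in> V \<Longrightarrow> \<zero>\<^bsub>H v\<^esub> \<in> carrier (H v)"
  using module_summand
  by (meson abelian_group.axioms(1) abelian_monoid.zero_closed complex_module_def module.axioms(2))

lemma
  shows zero_hilbert_sum: "\<zero>\<^bsub>S\<^esub> = (\<lambda>v\<in>V. \<zero>\<^bsub>H v\<^esub>)"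
    and add_hilbert_sum: "f \<oplus>\<^bsub>S\<^esub> g = (\<lambda>v\<in>V. f v \<oplus>\<^bsub>H v\<^esub> g v)"
    and smult_hilbert_sum: "a \<odot>\<^bsub>S\<^esub> f = (\<lambda>v\<in>V. a \<odot>\<^bsub>H v\<^esub> f v)"
    and hinner_hilbert_sum: "hinner S f g = (\<Sum>\<^sub>\<infinity>v\<in>V. hinner (H v) (f v) (g v))"
    and carrier_hilbert_sum: "carrier S =
      {f \<in> (\<Pi>\<^sub>E v\<in>V. carrier (H v)). (\<lambda>v. (hnorm (H v) (f v))\<^sup>2) summable_on V}"
  by (simp_all add: hilbert_sum_def)

lemma component_carrier [intro]: "\<lbrakk>f \<in> carrier S; v \<in> V\<rbrakk> \<Longrightarrow> f v \<in> carrier (H v)"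
  by (auto simp: carrier_hilbert_sum)

lemma hilbert_sum_ext:
  "\<lbrakk>f \<in> carrier S; g \<in> carrier S; \<And>v. v \<in> V \<Longrightarrow> f v = g v\<rbrakk> \<Longrightarrow> f = g"
  unfolding carrier_hilbert_sum by (blast intro: PiE_ext)

text \<open>Only closure of the carrier involves summability: for sums it follows by comparison with
  twice the two squared norms, for multiples by homogeneity. The algebraic laws then hold
  componentwise.\<close>

lemma complex_module_hilbert_sum: "complex_module S"
proof (rule complex_moduleI)
  fix f g assume fg: "f \<in> carrier S" "g \<in> carrier S"
  have "(\<lambda>v. (hnorm (H v) (f v \<oplus>\<^bsub>H v\<^esub> g v))\<^sup>2) summable_on V"
  proof (rule summable_on_comparison_test)
    show "(\<lambda>v. 2 * (hnorm (H v) (f v))\<^sup>2 + 2 * (hnorm (H v) (g v))\<^sup>2) summable_on V"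
      using fg by (intro summable_on_add summable_on_cmult_right) (auto simp: carrier_hilbert_sum)
    show "(hnorm (H v) (f v \<oplus>\<^bsub>H v\<^esub> g v))\<^sup>2
        \<le> 2 * (hnorm (H v) (f v))\<^sup>2 + 2 * (hnorm (H v) (g v))\<^sup>2" if "v \<in> V" for v
      using fg that by (intro hilbert_space.hnorm_add_square_le hilbert) auto
  qed simp
  then have "(\<lambda>v. (hnorm (H v) ((f \<oplus>\<^bsub>S\<^esub> g) v))\<^sup>2) summable_on V"
    by (rule summable_on_cong[THEN iffD1, rotated]) (simp add: add_hilbert_sum)
  moreover have "f v \<oplus>\<^bsub>H v\<^esub> g v \<in> carrier (H v)" if "v \<in> V" for v
  proof -
    interpret complex_module "H v" by (rule module_summand[OF that])
    show ?thesis using fg that by auto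
  qed
  ultimately show "f \<oplus>\<^bsub>S\<^esub> g \<in> carrier S"
    by (simp add: carrier_hilbert_sum add_hilbert_sum)
next
  show "\<zero>\<^bsub>S\<^esub> \<in> carrier S"
    by (auto simp: carrier_hilbert_sum zero_hilbert_sum hilbert hilbert_space.hnorm_zero
        intro!: summable_on_0)
next
  fix a f assume f: "f \<in> carrier S"
  have "(\<lambda>v. (cmod a)\<^sup>2 * (hnorm (H v) (f v))\<^sup>2) summable_on V"
    using f by (intro summable_on_cmult_right) (auto simp: carrier_hilbert_sum)
  then have "(\<lambda>v. (hnorm (H v) ((a \<odot>\<^bsub>S\<^esub> f) v))\<^sup>2) summable_on V"
    using f by (rule_tac summable_on_cong[THEN iffD1, rotated])
      (auto simp: smult_hilbert_sum hilbert hilbert_space.hnorm_smult_square component_carrier)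
  moreover have "a \<odot>\<^bsub>H v\<^esub> f v \<in> carrier (H v)" if "v \<in> V" for v
    using f that by (intro complex_module.smult_carrier module_summand) auto
  ultimately show "a \<odot>\<^bsub>S\<^esub> f \<in> carrier S"
    by (simp add: carrier_hilbert_sum smult_hilbert_sum)
next
  fix f g h assume "f \<in> carrier S" "g \<in> carrier S" "h \<in> carrier S"
  then have "f v \<oplus>\<^bsub>H v\<^esub> g v \<oplus>\<^bsub>H v\<^esub> h v = f v \<oplus>\<^bsub>H v\<^esub> (g v \<oplus>\<^bsub>H v\<^esub> h v)" if "v \<in> V" for v
  proof -
    interpret complex_module "H v" by (rule module_summand[OF that])
    show ?thesis using \<open>f \<in> carrier S\<close> \<open>g \<in> carrier S\<close> \<open>h \<in> carrier S\<close> that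
      by (auto intro!: a_assoc)
  qed
  then show "f \<oplus>\<^bsub>S\<^esub> g \<oplus>\<^bsub>S\<^esub> h = f \<oplus>\<^bsub>S\<^esub> (g \<oplus>\<^bsub>S\<^esub> h)"
    by (auto simp: add_hilbert_sum restrict_def fun_eq_iff)
next
  fix f g assume fg: "f \<in> carrier S" "g \<in> carrier S"
  have "f v \<oplus>\<^bsub>H v\<^esub> g v = g v \<oplus>\<^bsub>H v\<^esub> f v" if "v \<in> V" for v
  proof -
    interpret complex_module "H v" by (rule module_summand[OF that])
    show ?thesis using fg that by (auto intro!: a_comm)
  qed
  then show "f \<oplus>\<^bsub>S\<^esub> g = g \<oplus>\<^bsub>S\<^esub> f"
    by (auto simp: add_hilbert_sum restrict_def fun_eq_iff)
  fix a :: complex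
  have "a \<odot>\<^bsub>H v\<^esub> (f v \<oplus>\<^bsub>H v\<^esub> g v) = a \<odot>\<^bsub>H v\<^esub> f v \<oplus>\<^bsub>H v\<^esub> a \<odot>\<^bsub>H v\<^esub> g v" if "v \<in> V" for v
    using fg that by (intro complex_module.smult_add_right module_summand) auto
  then show "a \<odot>\<^bsub>S\<^esub> (f \<oplus>\<^bsub>S\<^esub> g) = a \<odot>\<^bsub>S\<^esub> f \<oplus>\<^bsub>S\<^esub> a \<odot>\<^bsub>S\<^esub> g"
    by (auto simp: add_hilbert_sum smult_hilbert_sum restrict_def fun_eq_iff)
next
  fix f assume f: "f \<in> carrier S"
  \<comment> \<open>The restricted operations return \<open>undefined\<close> outside
    \<open>V\<close>, so an identity with plain \<open>f\<close> on one side has to be checked there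
    as well.\<close>
  have ext: "f v = undefined" if "v \<notin> V" for v
    using f that by (auto simp: carrier_hilbert_sum)
  have "\<zero>\<^bsub>H v\<^esub> \<oplus>\<^bsub>H v\<^esub> f v = f v" if "v \<in> V" for v
  proof -
    interpret complex_module "H v" by (rule module_summand[OF that])
    show ?thesis using f that by (auto intro!: l_zero)
  qed
  then show "\<zero>\<^bsub>S\<^esub> \<oplus>\<^bsub>S\<^esub> f = f"
    by (auto simp: add_hilbert_sum zero_hilbert_sum restrict_def fun_eq_iff ext)
  have "0 \<odot>\<^bsub>H v\<^esub> f v = \<zero>\<^bsub>H v\<^esub>" "1 \<odot>\<^bsub>H v\<^esub> f v = f v" if "v \<in> V" for v
    using f that
    by (auto intro!: complex_module.zero_smult complex_module.one_smult module_summand)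
  then show "0 \<odot>\<^bsub>S\<^esub> f = \<zero>\<^bsub>S\<^esub>" "1 \<odot>\<^bsub>S\<^esub> f = f"
    by (auto simp: smult_hilbert_sum zero_hilbert_sum restrict_def fun_eq_iff ext)
  fix a b :: complex
  have "(a + b) \<odot>\<^bsub>H v\<^esub> f v = a \<odot>\<^bsub>H v\<^esub> f v \<oplus>\<^bsub>H v\<^esub> b \<odot>\<^bsub>H v\<^esub> f v"
    "(a * b) \<odot>\<^bsub>H v\<^esub> f v = a \<odot>\<^bsub>H v\<^esub> (b \<odot>\<^bsub>H v\<^esub> f v)" if "v \<in> V" for v
    using f that
    by (auto intro!: complex_module.smult_add_left module_summand
        complex_module.smult_smult[symmetric])
  then show "(a + b) \<odot>\<^bsub>S\<^esub> f = a \<odot>\<^bsub>S\<^esub> f \<oplus>\<^bsub>S\<^esub> b \<odot>\<^bsub>S\<^esub> f" "(a * b) \<odot>\<^bsub>S\<^esub> f = a \<odot>\<^bsub>S\<^esub> (b \<odot>\<^bsub>S\<^esub> f)"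
    by (auto simp: smult_hilbert_sum add_hilbert_sum restrict_def fun_eq_iff)
qed

sublocale sum: complex_module S
  by (rule complex_module_hilbert_sum)

section \<open>Embedded summands and vertex projections\<close>

lemma emb_component: "u \<in> V \<Longrightarrow> emb V H v x u = (if u = v then x else \<zero>\<^bsub>H u\<^esub>)"
  by (simp add: emb_def)

lemma emb_carrier [intro]: "\<lbrakk>v \<in> V; x \<in> carrier (H v)\<rbrakk> \<Longrightarrow> emb V H v x \<in> carrier S"
  unfolding carrier_hilbert_sum
  by (auto simp: emb_component hilbert hilbert_space.hnorm_zero emb_def
      intro!: finite_nonzero_values_imp_summable_on finite_subset[of _ "{v}"] split: if_splits)

lemma emb_zero: "v \<in> V \<Longrightarrow> emb V H v \<zero>\<^bsub>H v\<^esub> = \<zero>\<^bsub>S\<^esub>"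
  by (auto simp: emb_def zero_hilbert_sum restrict_def)

lemma emb_add:
  "\<lbrakk>v \<in> V; x \<in> carrier (H v); y \<in> carrier (H v)\<rbrakk> \<Longrightarrow>
    emb V H v (x \<oplus>\<^bsub>H v\<^esub> y) = emb V H v x \<oplus>\<^bsub>S\<^esub> emb V H v y"
  \<comment> \<open>Distributivity at the zero vector yields that zero plus zero is zero, which is
    the claim in the components other than \<open>v\<close>.\<close>
  using complex_module.smult_add_left[OF module_summand zero_H, of _ 1 0]
  by (auto simp: emb_def add_hilbert_sum restrict_def fun_eq_iff complex_module.smult_zero
      module_summand)

lemma emb_smult:
  "\<lbrakk>v \<in> V; x \<in> carrier (H v)\<rbrakk> \<Longrightarrow> emb V H v (a \<odot>\<^bsub>H v\<^esub> x) = a \<odot>\<^bsub>S\<^esub> emb V H v x"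
  by (auto simp: emb_def smult_hilbert_sum restrict_def fun_eq_iff complex_module.smult_zero
      module_summand)

lemma emb_in_summand: "\<lbrakk>v \<in> V; x \<in> carrier (H v)\<rbrakk> \<Longrightarrow> emb V H v x \<in> summand V H v"
  by (auto simp: summand_def emb_component)

lemma summand_eq_emb: "\<lbrakk>v \<in> V; f \<in> summand V H v\<rbrakk> \<Longrightarrow> f = emb V H v (f v)"
  by (rule hilbert_sum_ext) (auto simp: summand_def emb_component)

lemma summand_eq_image: "v \<in> V \<Longrightarrow> summand V H v = emb V H v ` carrier (H v)"
  using summand_eq_emb[of v] emb_in_summand[of v] by (auto simp: summand_def)

text \<open>The infinite sum collapses when the supports meet at most in \<open>v\<close>. This
  turns information about the graph of a walk into orthogonality.\<close>

lemma hinner_single: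
  assumes "v \<in> V" "f \<in> carrier S" "g \<in> carrier S"
    and "\<And>u. \<lbrakk>u \<in> V; u \<noteq> v\<rbrakk> \<Longrightarrow> f u = \<zero>\<^bsub>H u\<^esub> \<or> g u = \<zero>\<^bsub>H u\<^esub>"
  shows "hinner S f g = hinner (H v) (f v) (g v)"
proof -
  have "hinner (H u) (f u) (g u) = 0" if "u \<in> V - {v}" for u
  proof -
    interpret hilbert_space "H u" using that hilbert by simp
    have "f u \<in> carrier (H u)" "g u \<in> carrier (H u)"
      using assms(2,3) that by auto
    then show ?thesis using assms(4)[of u] that by auto
  qed
  then have "hinner S f g = (\<Sum>\<^sub>\<infinity>u\<in>{v}. hinner (H u) (f u) (g u))"
    unfolding hinner_hilbert_sum using assms(1) by (intro infsum_cong_neutral) auto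
  then show ?thesis by simp
qed

lemma hinner_emb_left:
  "\<lbrakk>v \<in> V; x \<in> carrier (H v); f \<in> carrier S\<rbrakk> \<Longrightarrow> hinner S (emb V H v x) f = hinner (H v) x (f v)"
  by (subst hinner_single[of v]) (auto simp: emb_component)

text \<open>Testing against vectors supported at a single index reduces the claim to nondegeneracy
  of each summand.\<close>

lemma hilbert_sum_hinner_ext:
  assumes fg: "f \<in> carrier S" "g \<in> carrier S"
    and eq: "\<And>h. h \<in> carrier S \<Longrightarrow> hinner S h f = hinner S h g"
  shows "f = g"
proof (rule hilbert_sum_ext[OF fg])
  fix v assume v: "v \<in> V"
  show "f v = g v"
  proof (rule hilbert_space.hinner_ext[OF hilbert[OF v]])
    fix z assume "z \<in> carrier (H v)"
    then show "hinner (H v) z (f v) = hinner (H v) z (g v)"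
      using eq[of "emb V H v z"] fg v by (simp add: hinner_emb_left emb_carrier)
  qed (use fg v in auto)
qed

text \<open>Resolves the definite description of the projection: truncating \<open>f\<close> to
  \<open>v\<close> satisfies the orthogonality condition, and test vectors supported at
  \<open>v\<close> determine the component of any other candidate.\<close>

lemma vertex_proj_eq:
  assumes v: "v \<in> V" and f: "f \<in> carrier S"
  shows "vertex_proj V H v f = emb V H v (f v)"
  unfolding vertex_proj_def orth_proj_def
proof (rule the_equality)
  show "emb V H v (f v) \<in> summand V H v \<and>
    (\<forall>z\<in>summand V H v. hinner S z (emb V H v (f v)) = hinner S z f)"
    using v f component_carrier[OF f v] emb_carrier[OF v component_carrier[OF f v]]
    by (auto simp: summand_eq_image emb_component hinner_emb_left)
next
  fix g assume g: "g \<in> summand V H v \<and> (\<forall>z\<in>summand V H v. hinner S z g = hinner S z f)"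
  then have gc: "g \<in> carrier S"
    by (simp add: summand_def)
  have "g v = f v"
  proof (rule hilbert_space.hinner_ext[OF hilbert[OF v]])
    fix z assume "z \<in> carrier (H v)"
    then show "hinner (H v) z (g v) = hinner (H v) z (f v)"
      using g gc f v emb_in_summand[of v z] hinner_emb_left[of v z] by auto
  qed (use gc f v in auto)
  then show "g = emb V H v (f v)"
    using summand_eq_emb[OF v, of g] g by simp
qed

end

section \<open>The space C2\<close>

lemma C2_simps [simp]:
  "carrier C2 = UNIV" "zero C2 = 0" "add C2 = (+)" "smult C2 = (*s)"
  by (simp_all add: C2_def)

lemma hinner_C2: "hinner C2 x y = cnj (x $ 1) * y $ 1 + cnj (x $ 2) * y $ 2"
  by (simp add: C2_def sum_2)

lemma hnorm_C2: "hnorm C2 x = norm x"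
  by (simp add: hnorm_def hinner_C2 norm_vec_def L2_set_def sum_2 cmod_power2)
    (simp add: power2_eq_square)

lemma complex_module_C2: "complex_module C2"
  by (rule complex_moduleI) (simp_all add: vec_eq_iff algebra_simps)

text \<open>Once the metric is the Euclidean one, completeness and separability are those of the
  type \<open>complex^2\<close>.\<close>

lemma hdist_C2: "hdist C2 = dist"
proof -
  interpret complex_module C2 by (rule complex_module_C2)
  have "x \<ominus>\<^bsub>C2\<^esub> y = x - y" for x y
    using neg_one_smult[of y] by (simp add: a_minus_def vec_eq_iff)
  then show ?thesis
    by (simp add: fun_eq_iff hdist_def hnorm_C2 dist_norm)
qed

lemma separable_hilbert_space_C2: "separable_hilbert_space C2"
proof -
  interpret complex_module C2 by (rule complex_module_C2)
  have "hilbert_space C2"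
  proof
    fix x :: "complex^2" assume "x \<noteq> \<zero>\<^bsub>C2\<^esub>"
    then have "hnorm C2 x > 0"
      by (simp add: hnorm_C2)
    then show "Re (hinner C2 x x) > 0"
      by (simp add: hnorm_def)
  qed (simp_all add: hinner_C2 hdist_C2 algebra_simps complete_UNIV)
  moreover have "separable_space (euclidean :: (complex^2) topology)"
  proof -
    obtain D :: "(complex^2) set" where "countable D"
      and "\<And>T. open T \<Longrightarrow> T \<noteq> {} \<Longrightarrow> \<exists>d\<in>D. d \<in> T"
      using countable_dense_setE by blast
    then have "\<exists>d\<in>D. dist d x < e" if "e > 0" for x e
      using that by (metis centre_in_ball dist_commute empty_iff mem_ball open_ball)
    then have "closure D = UNIV"
      by (auto simp: closure_approachable)
    then show ?thesis
      using \<open>countable D\<close> by (auto simp: separable_space_def)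
  qed
  ultimately show ?thesis
    by (simp add: separable_hilbert_space_def hdist_C2)
qed

lemma hilbert_space_C2: "hilbert_space C2"
  using separable_hilbert_space_C2 by (simp add: separable_hilbert_space_def)

text \<open>The matrix has rows \<open>(cnj p, cnj q)\<close> and \<open>(- q, p)\<close>. It lies
  in SU(2) and sends the unit vector \<open>(p, q)\<close> to the first basis vector.\<close>

lemma unitary_rotation_C2:
  assumes "p * cnj p + q * cnj q = 1"
  shows "unitary C2 C2
    (\<lambda>u. vector [cnj p * u $ 1 + cnj q * u $ 2, p * u $ 2 - q * u $ 1])"
proof (rule unitaryI)
  let ?v = "\<lambda>u :: complex^2.
    vector [cnj p * u $ 1 + cnj q * u $ 2, p * u $ 2 - q * u $ 1] :: complex^2"
  fix x y :: "complex^2"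
  have "hinner C2 (?v x) (?v y) =
      (p * cnj p + q * cnj q) * (cnj (x $ 1) * y $ 1 + cnj (x $ 2) * y $ 2)"
    by (simp add: hinner_C2 algebra_simps)
  then show "hinner C2 (?v x) (?v y) = hinner C2 x y"
    using assms by (simp add: hinner_C2)
  \<comment> \<open>The preimage of \<open>y\<close> is obtained with the conjugate transpose of the
    matrix.\<close>
  let ?u = "vector [p * y $ 1 - cnj q * y $ 2, q * y $ 1 + cnj p * y $ 2] :: complex^2"
  have "cnj p * ?u $ 1 + cnj q * ?u $ 2 = (p * cnj p + q * cnj q) * y $ 1"
    "p * ?u $ 2 - q * ?u $ 1 = (p * cnj p + q * cnj q) * y $ 2"
    by (simp_all add: algebra_simps)
  then have "?v ?u = y"
    using assms by (simp add: vec_eq_iff forall_2)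
  then show "\<exists>x\<in>carrier C2. ?v x = y"
    by (intro bexI[of _ ?u]) simp_all
  show "x = y" if "\<And>z. z \<in> carrier C2 \<Longrightarrow> hinner C2 z x = hinner C2 z y"
    using hilbert_space.hinner_ext[OF hilbert_space_C2, of x y] that by simp
qed (simp_all add: vec_eq_iff forall_2 algebra_simps)

text \<open>Gram-Schmidt: subtracting from \<open>y\<close> its projection on \<open>x\<close> gives
  an orthogonal basis \<open>x\<close>, \<open>t\<close>, and independence of \<open>x\<close> and
  \<open>y\<close> keeps \<open>t\<close> nonzero.\<close>

lemma (in hilbert_space) ex_unitary_C2:
  assumes "hdim H (carrier H) = 2"
  shows "\<exists>w. unitary H C2 w"
proof -
  obtain x y where xy: "x \<in> carrier H" "y \<in> carrier H"
    and indep: "\<And>a b. a \<odot> x \<oplus> b \<odot> y = \<zero> \<Longrightarrow> a = 0 \<and> b = 0"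
    and span: "\<And>z. z \<in> carrier H \<Longrightarrow> \<exists>a b. z = a \<odot> x \<oplus> b \<odot> y"
    using hdim_twoD[OF assms] by metis
  define k where "k = hinner H x y / hinner H x x"
  define t where "t = y \<oplus> (- k) \<odot> x"
  have t: "t \<in> carrier H"
    using xy by (simp add: t_def)
  have "x \<noteq> \<zero>"
    using indep[of 1 0] xy by auto
  moreover have "t \<noteq> \<zero>"
    using indep[of "- k" 1] xy by (auto simp: t_def a_comm)
  ultimately have pos: "hnorm H x > 0" "hnorm H t > 0"
    using xy t by (auto intro: hnorm_pos)
  have xt: "hinner H x t = 0"
    using xy pos by (simp add: t_def k_def hinner_add_right hinner_smult_right hinner_self)
  have tx: "hinner H t x = 0"
    using xt hinner_commute[of x t] xy t by simp
  have y: "y = k \<odot> x \<oplus> t"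
    using xy by (simp add: t_def a_lcomm[of "k \<odot> x"] flip: smult_add_left)
  \<comment> \<open>These are the coordinates with respect to the normalised vectors
    \<open>x\<close> and \<open>t\<close>.\<close>
  define w :: "'a \<Rightarrow> complex^2" where
    "w z = vector [hinner H x z / hnorm H x, hinner H t z / hnorm H t]" for z
  have comb: "w (a \<odot> x \<oplus> b \<odot> t) = vector [a * hnorm H x, b * hnorm H t]" for a b
    using xy t pos xt tx
    by (simp add: w_def hinner_add_right hinner_smult_right hinner_self power2_eq_square)
  have span': "\<exists>a b. z = a \<odot> x \<oplus> b \<odot> t" if z: "z \<in> carrier H" for z
  proof -
    obtain a b where "z = a \<odot> x \<oplus> b \<odot> y"
      using span[OF z] by auto
    then have "z = (a + b * k) \<odot> x \<oplus> b \<odot> t"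
      using xy t by (subst (asm) y) (simp add: smult_add_left smult_add_right smult_smult a_assoc)
    then show ?thesis by blast
  qed
  have "unitary H C2 w"
  proof (rule unitaryI)
    fix v :: "complex^2"
    let ?a = "v $ 1 / hnorm H x" and ?b = "v $ 2 / hnorm H t"
    have "w (?a \<odot> x \<oplus> ?b \<odot> t) = v"
      using pos by (simp only: comb) (simp add: vec_eq_iff forall_2)
    then show "\<exists>z\<in>carrier H. w z = v"
      using xy t by (intro bexI[of _ "?a \<odot> x \<oplus> ?b \<odot> t"]) auto
  next
    fix z z' assume z: "z \<in> carrier H" "z' \<in> carrier H"
    then show "w (z \<oplus> z') = w z \<oplus>\<^bsub>C2\<^esub> w z'"
      using xy t by (simp add: w_def vec_eq_iff forall_2 hinner_add_right add_divide_distrib)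
    obtain a b a' b' where ab: "z = a \<odot> x \<oplus> b \<odot> t" "z' = a' \<odot> x \<oplus> b' \<odot> t"
      using span' z by metis
    then have "hinner C2 (w z) (w z') = cnj a * a' * (hnorm H x)\<^sup>2 + cnj b * b' * (hnorm H t)\<^sup>2"
      by (simp add: comb hinner_C2 power2_eq_square)
    also have "\<dots> = hinner H z z'"
      using xy t xt tx unfolding ab
      by (simp add: hinner_add_left hinner_add_right hinner_smult_left hinner_smult_right
          hinner_self)
    finally show "hinner C2 (w z) (w z') = hinner H z z'" .
    show "z = z'" if "\<And>u. u \<in> carrier H \<Longrightarrow> hinner H u z = hinner H u z'"
      using hinner_ext z that by blast
  next
    fix a z assume "z \<in> carrier H"
    then show "w (a \<odot> z) = a \<odot>\<^bsub>C2\<^esub> w z"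
      using xy t by (simp add: w_def vec_eq_iff forall_2 hinner_smult_right)
  qed simp
  then show ?thesis
    by blast
qed

text \<open>An arbitrary unitary to \<open>C2\<close> is followed by the rotation that turns the
  normalised vector \<open>(p, q)\<close> of \<open>w s\<close> into the first axis.\<close>

lemma (in hilbert_space) ex_unitary_C2_axis:
  assumes "hdim H (carrier H) = 2" and s: "s \<in> carrier H" "s \<noteq> \<zero>"
  obtains w :: "'a \<Rightarrow> complex^2"
    where "unitary H C2 w" "w s $ 1 \<noteq> 0" "w s $ 2 = 0"
proof -
  obtain w where w: "unitary H C2 w"
    using ex_unitary_C2[OF assms(1)] by blast
  have ws: "w s \<noteq> 0"
    using unitary_eq_zero_iff[OF w complex_module_axioms complex_module_C2 s(1)] s(2) by simp
  define p q where "p = w s $ 1 / norm (w s)" and "q = w s $ 2 / norm (w s)"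
  have sq: "hinner C2 (w s) (w s) = of_real ((norm (w s))\<^sup>2)"
    using hilbert_space.hinner_self[OF hilbert_space_C2, of "w s"] by (simp add: hnorm_C2)
  have 1: "p * cnj p + q * cnj q = 1"
    using sq ws by (simp add: p_def q_def hinner_C2 field_simps power2_eq_square)
  let ?w = "\<lambda>z. vector [cnj p * w z $ 1 + cnj q * w z $ 2, p * w z $ 2 - q * w z $ 1] :: complex^2"
  have "unitary H C2 ?w"
    by (rule unitary_comp[OF w unitary_rotation_C2[OF 1]])
  moreover have "?w s $ 1 = norm (w s) * (p * cnj p + q * cnj q)"
    using ws by (simp add: p_def q_def algebra_simps)
  moreover have "?w s $ 2 = 0"
    by (simp add: p_def q_def)
  ultimately show ?thesis
    using that[of ?w] 1 ws by simp
qed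

section \<open>Conjugation by a family of unitaries\<close>

text \<open>A choice of coordinates at every vertex. The direct sum \<open>W\<close> of these maps
  respects the vertex decomposition, so conjugation by it gives an equivalent walk with the identity
  as vertex bijection.\<close>

locale unitary_family =
  H: hilbert_family V H + K: hilbert_family V K
  for V :: "'v set" and H :: "'v \<Rightarrow> 'a inner_space" and K :: "'v \<Rightarrow> 'b inner_space" +
  fixes w :: "'v \<Rightarrow> 'a \<Rightarrow> 'b"
  assumes w: "v \<in> V \<Longrightarrow> unitary (H v) (K v) (w v)"
begin

definition W :: "('v \<Rightarrow> 'a) \<Rightarrow> ('v \<Rightarrow> 'b)" where
  "W f = (\<lambda>v\<in>V. w v (f v))"

definition W_inv :: "('v \<Rightarrow> 'b) \<Rightarrow> ('v \<Rightarrow> 'a)" where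
  "W_inv = inv_into (carrier H.S) W"

lemma w_zero: "v \<in> V \<Longrightarrow> w v \<zero>\<^bsub>H v\<^esub> = \<zero>\<^bsub>K v\<^esub>"
  by (rule unitary_zero[OF w H.module_summand K.module_summand])

lemma unitary_W: "unitary H.S K.S W"
proof (rule unitaryI)
  have norm: "hnorm (K v) (w v x) = hnorm (H v) x" if "v \<in> V" "x \<in> carrier (H v)" for v x
    using unitary_hinner[OF w, of v x x] that by (simp add: hnorm_def)
  fix f assume f: "f \<in> carrier H.S"
  have "(\<lambda>v. (hnorm (K v) (W f v))\<^sup>2) summable_on V \<longleftrightarrow> (\<lambda>v. (hnorm (H v) (f v))\<^sup>2) summable_on V"
    using f by (intro summable_on_cong) (simp add: W_def norm H.component_carrier)
  then show "W f \<in> carrier K.S"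
    using f unfolding K.carrier_hilbert_sum H.carrier_hilbert_sum
    by (auto simp: W_def intro!: unitary_carrier[OF w])
  show "W (a \<odot>\<^bsub>H.S\<^esub> f) = a \<odot>\<^bsub>K.S\<^esub> W f" for a
    using f by (auto simp: W_def H.smult_hilbert_sum K.smult_hilbert_sum fun_eq_iff
        unitary_smult[OF w] H.component_carrier)
  fix g assume g: "g \<in> carrier H.S"
  show "W (f \<oplus>\<^bsub>H.S\<^esub> g) = W f \<oplus>\<^bsub>K.S\<^esub> W g"
    using f g by (auto simp: W_def H.add_hilbert_sum K.add_hilbert_sum fun_eq_iff
        unitary_add[OF w] H.component_carrier)
  show "hinner K.S (W f) (W g) = hinner H.S f g"
    using f g by (auto simp: W_def H.hinner_hilbert_sum K.hinner_hilbert_sum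
        unitary_hinner[OF w] H.component_carrier intro!: infsum_cong)
  show "f = g" if "\<And>h. h \<in> carrier H.S \<Longrightarrow> hinner H.S h f = hinner H.S h g"
    by (rule H.hilbert_sum_hinner_ext[OF f g that])
next
  fix g assume g: "g \<in> carrier K.S"
  \<comment> \<open>Surjectivity: invert each component. The family stays square summable because
    every \<open>w v\<close> preserves norms.\<close>
  define f where "f = (\<lambda>v\<in>V. inv_into (carrier (H v)) (w v) (g v))"
  have fv: "f v \<in> carrier (H v)" "w v (f v) = g v" if "v \<in> V" for v
    using that g unitary_inv_carrier[OF w] unitary_inv_right[OF w]
    by (auto simp: f_def K.component_carrier)
  have "(\<lambda>v. (hnorm (H v) (f v))\<^sup>2) summable_on V \<longleftrightarrow> (\<lambda>v. (hnorm (K v) (g v))\<^sup>2) summable_on V"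
    using unitary_hinner[OF w] fv by (intro summable_on_cong) (metis hnorm_def)
  then have "f \<in> carrier H.S"
    using g fv(1) by (auto simp: H.carrier_hilbert_sum K.carrier_hilbert_sum f_def)
  moreover have "W f = g"
    using fv(2) g by (auto simp: W_def fun_eq_iff K.carrier_hilbert_sum)
  ultimately show "\<exists>f\<in>carrier H.S. W f = g" by blast
qed

lemmas W_carrier = unitary_carrier[OF unitary_W]
lemmas W_inv_carrier = unitary_inv_carrier[OF unitary_W, folded W_inv_def]
lemmas W_W_inv = unitary_inv_right[OF unitary_W, folded W_inv_def]
lemmas unitary_W_inv = unitary_inv[OF unitary_W H.complex_module_hilbert_sum, folded W_inv_def]

lemma W_component: "v \<in> V \<Longrightarrow> W f v = w v (f v)"
  by (simp add: W_def)

lemma W_emb: "\<lbrakk>v \<in> V; x \<in> carrier (H v)\<rbrakk> \<Longrightarrow> W (emb V H v x) = emb V K v (w v x)"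
  by (auto simp: W_def emb_def fun_eq_iff w_zero)

lemma w_image: "v \<in> V \<Longrightarrow> w v ` carrier (H v) = carrier (K v)"
  using unitary_bij[OF w] by (simp add: bij_betw_def)

lemma W_summand:
  assumes "v \<in> V"
  shows "W ` summand V H v = summand V K v"
proof -
  have "W ` summand V H v = emb V K v ` w v ` carrier (H v)"
    using assms W_emb[of v] by (simp add: H.summand_eq_image image_image)
  then show ?thesis
    using assms by (simp add: K.summand_eq_image w_image)
qed

lemma W_vertex_proj:
  assumes "v \<in> V" "f \<in> carrier H.S"
  shows "W (vertex_proj V H v f) = vertex_proj V K v (W f)"
  using assms by (simp add: H.vertex_proj_eq K.vertex_proj_eq W_carrier W_emb H.component_carrier
      W_component)

section \<open>The conjugated walk, its blocks and its edge multiplicities\<close>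

definition conj_walk :: "(('v \<Rightarrow> 'a) \<Rightarrow> ('v \<Rightarrow> 'a)) \<Rightarrow> (('v \<Rightarrow> 'b) \<Rightarrow> ('v \<Rightarrow> 'b))" where
  "conj_walk U g = W (U (W_inv g))"

lemma unitary_conj_walk: "unitary H.S H.S U \<Longrightarrow> unitary K.S K.S (conj_walk U)"
  unfolding conj_walk_def[abs_def]
  by (rule unitary_comp[OF unitary_comp[OF unitary_W_inv] unitary_W])

text \<open>\<open>W\<close> intertwines the vertex projections of the two decompositions, hence
  conjugating \<open>U\<close> conjugates every block.\<close>

lemma walk_block_conj_walk:
  assumes U: "unitary H.S H.S U" and v: "u \<in> V" "v \<in> V" and g: "g \<in> carrier K.S"
  shows "walk_block V K (conj_walk U) u v g = W (walk_block V H U u v (W_inv g))"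
proof -
  have f: "W_inv g \<in> carrier H.S" "W (W_inv g) = g"
    using W_inv_carrier[OF g] W_W_inv[OF g] .
  have p: "vertex_proj V H v (W_inv g) \<in> carrier H.S"
    using f(1) v by (simp add: H.vertex_proj_eq H.emb_carrier H.component_carrier)
  have "vertex_proj V K v g = W (vertex_proj V H v (W_inv g))"
    using W_vertex_proj[OF v(2) f(1)] f(2) by simp
  moreover have "W_inv (W (vertex_proj V H v (W_inv g))) = vertex_proj V H v (W_inv g)"
    unfolding W_inv_def by (rule unitary_inv_left[OF unitary_W p[unfolded W_inv_def]])
  ultimately show ?thesis
    using W_vertex_proj[OF v(1) unitary_carrier[OF U p]] by (simp add: walk_block_def conj_walk_def)
qed

lemma walk_block_carrier:
  assumes U: "unitary H.S H.S U" and v: "u \<in> V" "v \<in> V" and f: "f \<in> carrier H.S"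
  shows "walk_block V H U u v f \<in> carrier H.S"
  using assms unitary_carrier[OF U]
  by (simp add: walk_block_def H.vertex_proj_eq H.emb_carrier H.component_carrier)

text \<open>\<open>W_inv\<close> is onto, so the range of the new block is the image under
  \<open>W\<close> of the range of the old one, and unitaries preserve dimension.\<close>

lemma edge_card_conj_walk:
  assumes U: "unitary H.S H.S U" and v: "u \<in> V" "v \<in> V"
  shows "edge_card V K (conj_walk U) u v = edge_card V H U u v"
proof -
  have "walk_block V K (conj_walk U) u v ` carrier K.S =
      W ` walk_block V H U u v ` W_inv ` carrier K.S"
    using walk_block_conj_walk[OF assms] by (simp add: image_image)
  also have "W_inv ` carrier K.S = carrier H.S"
    using unitary_bij[OF unitary_W_inv] by (simp add: bij_betw_def)
  finally show ?thesis
    unfolding edge_card_def rank_op_def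
    using hdim_unitary_image[OF unitary_W H.complex_module_hilbert_sum K.complex_module_hilbert_sum,
        of "walk_block V H U u v ` carrier H.S"] walk_block_carrier[OF assms]
    by auto
qed

lemma unitary_equivalent_conj_walk: "unitary_equivalent V H U V K (conj_walk U)"
  unfolding unitary_equivalent_def
proof (intro exI conjI ballI)
  show "unitary H.S K.S W" "bij_betw id V V"
    by (rule unitary_W, simp)
  show "W ` summand V H v = summand V K (id v)" if "v \<in> V" for v
    using W_summand[OF that] by simp
  \<comment> \<open>The adjoint of \<open>W\<close> is its inverse, which is what
    \<open>conj_walk\<close> uses.\<close>
  show "W (U (adjoint_op H.S K.S W g)) = conj_walk U g" if "g \<in> carrier K.S" for g
    by (subst adjoint_op_unitary[OF unitary_W that H.hilbert_sum_hinner_ext])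
      (simp_all add: conj_walk_def W_inv_def)
qed

end

section \<open>One-dimensional walks\<close>

locale line_walk =
  fixes H :: "int \<Rightarrow> 'a inner_space" and U :: "(int \<Rightarrow> 'a) \<Rightarrow> (int \<Rightarrow> 'a)"
  assumes walk: "one_dim_walk H U"

sublocale line_walk \<subseteq> hilbert_family UNIV H
  using walk by (intro hilbert_family.intro)
    (simp add: one_dim_walk_def quantum_walk_def separable_hilbert_space_def)

context line_walk
begin

lemma unitary_U: "unitary S S U"
  using walk by (simp add: one_dim_walk_def quantum_walk_def)

lemma hdim_H: "hdim (H n) (carrier (H n)) = 2"
  using walk by (simp add: one_dim_walk_def)

text \<open>The block as a map from \<open>H n\<close> to \<open>H m\<close>, in place of the
  operator \<open>walk_block\<close> on the whole sum.\<close>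

definition block :: "int \<Rightarrow> int \<Rightarrow> 'a \<Rightarrow> 'a" where
  "block m n x = U (emb UNIV H n x) m"

lemma U_emb_carrier: "x \<in> carrier (H n) \<Longrightarrow> U (emb UNIV H n x) \<in> carrier S"
  by (simp add: unitary_carrier[OF unitary_U] emb_carrier)

lemma block_carrier: "x \<in> carrier (H n) \<Longrightarrow> block m n x \<in> carrier (H m)"
  by (simp add: block_def U_emb_carrier component_carrier)

lemma block_add:
  "\<lbrakk>x \<in> carrier (H n); y \<in> carrier (H n)\<rbrakk> \<Longrightarrow>
    block m n (x \<oplus>\<^bsub>H n\<^esub> y) = block m n x \<oplus>\<^bsub>H m\<^esub> block m n y"
  by (simp add: block_def emb_add unitary_add[OF unitary_U] emb_carrier)
    (simp add: add_hilbert_sum)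

lemma block_smult:
  "x \<in> carrier (H n) \<Longrightarrow> block m n (a \<odot>\<^bsub>H n\<^esub> x) = a \<odot>\<^bsub>H m\<^esub> block m n x"
  by (simp add: block_def emb_smult unitary_smult[OF unitary_U] emb_carrier)
    (simp add: smult_hilbert_sum)

lemma walk_block_eq:
  "f \<in> carrier S \<Longrightarrow> walk_block UNIV H U m n f = emb UNIV H m (block m n (f n))"
  by (simp add: walk_block_def block_def vertex_proj_eq component_carrier U_emb_carrier)

lemma walk_block_carrier: "f \<in> carrier S \<Longrightarrow> walk_block UNIV H U m n f \<in> carrier S"
  by (simp add: walk_block_eq block_carrier component_carrier emb_carrier)

lemma walk_block_emb:
  "x \<in> carrier (H n) \<Longrightarrow> walk_block UNIV H U m n (emb UNIV H n x) m = block m n x"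
  by (simp add: walk_block_eq emb_carrier emb_component)

text \<open>A missing edge means rank zero, so the range of the block is trivial. The case
  \<open>m = n\<close> is included: the graph has no loops.\<close>

lemma block_eq_zero:
  assumes mn: "m \<noteq> n + 1" "m \<noteq> n - 1" and x: "x \<in> carrier (H n)"
  shows "block m n x = \<zero>\<^bsub>H m\<^esub>"
proof -
  have "(m, n) \<notin> walk_edges UNIV H U"
    using walk mn by (auto simp: one_dim_walk_def)
  then have "walk_block UNIV H U m n ` carrier S = {\<zero>\<^bsub>S\<^esub>}"
    by (intro sum.hdim_zeroD) (simp add: walk_edges_def edge_card_def rank_op_def)
  then have "walk_block UNIV H U m n (emb UNIV H n x) = \<zero>\<^bsub>S\<^esub>"
    using x emb_carrier[of n x] by blast
  then show ?thesis
    using walk_block_emb[OF x, of m] by (simp add: zero_hilbert_sum)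
qed

text \<open>Multiplicity one of the edge concerns an operator on the whole sum. A generator of its
  range is supported at \<open>m\<close>, and its component there generates the range of
  \<open>block m n\<close>.\<close>

lemma block_range:
  assumes "m = n + 1 \<or> m = n - 1"
  obtains r where "r \<in> carrier (H m)" "r \<noteq> \<zero>\<^bsub>H m\<^esub>"
    "block m n ` carrier (H n) = range (\<lambda>c. c \<odot>\<^bsub>H m\<^esub> r)"
proof -
  interpret M: complex_module "H m"
    by (simp add: module_summand)
  have card: "edge_card UNIV H U k (k + 1) = 1" "edge_card UNIV H U (k + 1) k = 1" for k
    using walk by (auto simp: one_dim_walk_def)
  have "edge_card UNIV H U m n = 1"
    using assms card(1)[of m] card(2)[of n] by auto
  then have "hdim S (walk_block UNIV H U m n ` carrier S) = 1"
    by (simp add: edge_card_def rank_op_def)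
  then obtain \<rho> where \<rho>: "\<rho> \<in> carrier S" "\<rho> \<noteq> \<zero>\<^bsub>S\<^esub>"
    and range: "walk_block UNIV H U m n ` carrier S = range (\<lambda>c. c \<odot>\<^bsub>S\<^esub> \<rho>)"
    using sum.hdim_oneD[of "walk_block UNIV H U m n ` carrier S"] walk_block_carrier by blast
  \<comment> \<open>The generator is its own multiple by one, so it is attained and has the embedded
    form of the elements of the range.\<close>
  have "1 \<odot>\<^bsub>S\<^esub> \<rho> \<in> walk_block UNIV H U m n ` carrier S"
    unfolding range by blast
  then obtain f where f: "f \<in> carrier S" "\<rho> = emb UNIV H m (block m n (f n))"
    using \<rho>(1) by (auto simp: walk_block_eq)
  have \<rho>m: "\<rho> m = block m n (f n)"
    by (simp add: f(2) emb_component)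
  have "block m n ` carrier (H n) = range (\<lambda>c. c \<odot>\<^bsub>H m\<^esub> \<rho> m)"
  proof (intro equalityI subsetI)
    fix y assume "y \<in> block m n ` carrier (H n)"
    then obtain x where x: "x \<in> carrier (H n)" "y = block m n x"
      by blast
    then have "walk_block UNIV H U m n (emb UNIV H n x) \<in> range (\<lambda>c. c \<odot>\<^bsub>S\<^esub> \<rho>)"
      using emb_carrier[of n x] range by blast
    then obtain c where "walk_block UNIV H U m n (emb UNIV H n x) = c \<odot>\<^bsub>S\<^esub> \<rho>"
      by blast
    then have "y = c \<odot>\<^bsub>H m\<^esub> \<rho> m"
      using walk_block_emb[OF x(1), of m] x(2) by (simp add: smult_hilbert_sum)
    then show "y \<in> range (\<lambda>c. c \<odot>\<^bsub>H m\<^esub> \<rho> m)"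
      by blast
  next
    fix y assume "y \<in> range (\<lambda>c. c \<odot>\<^bsub>H m\<^esub> \<rho> m)"
    then obtain c where "y = c \<odot>\<^bsub>H m\<^esub> \<rho> m"
      by blast
    then have "y = block m n (c \<odot>\<^bsub>H n\<^esub> f n)"
      using f(1) by (simp add: \<rho>m block_smult component_carrier)
    then show "y \<in> block m n ` carrier (H n)"
      using f(1) by (simp add: complex_module.smult_carrier module_summand component_carrier)
  qed
  moreover have "\<rho> m \<noteq> \<zero>\<^bsub>H m\<^esub>"
    using \<rho>(2) f(2) \<rho>m by (auto simp: emb_zero)
  ultimately show ?thesis
    using that \<rho>(1) component_carrier by blast
qed

section \<open>Orthogonality of ranges and of kernels\<close>

lemma hinner_U_emb:
  assumes "x \<in> carrier (H n)" "y \<in> carrier (H k)"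
  shows "hinner S (U (emb UNIV H n x)) (U (emb UNIV H k y)) = hinner S (emb UNIV H n x) (emb UNIV H k y)"
  using assms by (simp add: unitary_hinner[OF unitary_U] emb_carrier)

text \<open>The only common neighbour of \<open>n - 1\<close> and \<open>n + 1\<close> is
  \<open>n\<close>, so the inner product of the two images is the one in \<open>H n\<close>. By
  unitarity it equals that of the sources, which sit at different vertices.\<close>

lemma ranges_orthogonal:
  assumes x: "x \<in> carrier (H k)" and y: "y \<in> carrier (H l)"
    and kl: "k = n + 1 \<and> l = n - 1 \<or> k = n - 1 \<and> l = n + 1"
  shows "hinner (H n) (block n k x) (block n l y) = 0"
proof -
  have "hinner (H n) (block n k x) (block n l y) = hinner S (U (emb UNIV H k x)) (U (emb UNIV H l y))"
    unfolding block_def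
  proof (rule hinner_single[symmetric])
    fix u assume "u \<noteq> n"
    then have "(u \<noteq> k + 1 \<and> u \<noteq> k - 1) \<or> (u \<noteq> l + 1 \<and> u \<noteq> l - 1)"
      using kl by auto
    then show "U (emb UNIV H k x) u = \<zero>\<^bsub>H u\<^esub> \<or> U (emb UNIV H l y) u = \<zero>\<^bsub>H u\<^esub>"
      using block_eq_zero[OF _ _ x] block_eq_zero[OF _ _ y] unfolding block_def by blast
  qed (simp_all add: x y U_emb_carrier)
  also have "\<dots> = hinner (H k) x (emb UNIV H l y k)"
    using x y by (simp add: hinner_U_emb hinner_emb_left emb_carrier)
  also have "\<dots> = 0"
    using x kl by (auto simp: emb_component hilbert_space.hinner_zero_right hilbert)
  finally show ?thesis .
qed

text \<open>Away from \<open>n - 1\<close> and \<open>n + 1\<close> both images vanish by the shape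
  of the graph, and at each of these two sites one of them vanishes by hypothesis. Hence the images
  have disjoint supports, and \<open>U\<close> preserves the inner product.\<close>

lemma kernels_orthogonal:
  assumes x: "x \<in> carrier (H n)" "block k n x = \<zero>\<^bsub>H k\<^esub>"
    and y: "y \<in> carrier (H n)" "block l n y = \<zero>\<^bsub>H l\<^esub>"
    and kl: "k = n + 1 \<and> l = n - 1 \<or> k = n - 1 \<and> l = n + 1"
  shows "hinner (H n) x y = 0"
proof -
  have "hinner (H n) x y = hinner S (U (emb UNIV H n x)) (U (emb UNIV H n y))"
    using x y by (simp add: hinner_U_emb hinner_emb_left emb_carrier emb_component)
  \<comment> \<open>The sum is collapsed to the site \<open>n\<close>, where both images vanish for
    want of a loop.\<close>
  also have "\<dots> = hinner (H n) (block n n x) (block n n y)"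
    unfolding block_def
  proof (rule hinner_single)
    fix u assume "u \<noteq> n"
    have "u = k \<or> u = l \<or> (u \<noteq> n + 1 \<and> u \<noteq> n - 1)"
      using kl by auto
    then show "U (emb UNIV H n x) u = \<zero>\<^bsub>H u\<^esub> \<or> U (emb UNIV H n y) u = \<zero>\<^bsub>H u\<^esub>"
      using block_eq_zero[OF _ _ x(1)] x(2) y(2) unfolding block_def by blast
  qed (simp_all add: x y U_emb_carrier)
  also have "\<dots> = 0"
    using x(1) y(1) by (simp add: block_eq_zero hilbert_space.hinner_zero_right hilbert)
  finally show ?thesis .
qed

text \<open>\<open>k\<close> and \<open>l\<close> name the two neighbours in either order. The order
  decides which of the two incoming ranges becomes the first axis of \<open>H n\<close>; one order
  serves \<open>class_C1\<close>, the other \<open>class_C3\<close>.\<close>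

lemma ex_range_frame:
  assumes kl: "\<And>n. k n = n + 1 \<and> l n = n - 1 \<or> k n = n - 1 \<and> l n = n + 1"
  obtains w :: "int \<Rightarrow> 'a \<Rightarrow> complex^2"
  where "\<And>n. unitary (H n) C2 (w n)"
    and "\<And>n x. x \<in> carrier (H (k n)) \<Longrightarrow> w n (block n (k n) x) $ 2 = 0"
    and "\<And>n x. x \<in> carrier (H (l n)) \<Longrightarrow> w n (block n (l n) x) $ 1 = 0"
proof -
  have "\<exists>w :: 'a \<Rightarrow> complex^2. unitary (H n) C2 w \<and>
    (\<forall>x\<in>carrier (H (k n)). w (block n (k n) x) $ 2 = 0) \<and>
    (\<forall>x\<in>carrier (H (l n)). w (block n (l n) x) $ 1 = 0)" for n
  proof -
    have "n = k n + 1 \<or> n = k n - 1"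
      using kl[of n] by auto
    then obtain r where r: "r \<in> carrier (H n)" "r \<noteq> \<zero>\<^bsub>H n\<^esub>"
      and range: "block n (k n) ` carrier (H (k n)) = range (\<lambda>c. c \<odot>\<^bsub>H n\<^esub> r)"
      using block_range by blast
    interpret N: hilbert_space "H n"
      by (rule hilbert) simp
    obtain w :: "'a \<Rightarrow> complex^2" where w: "unitary (H n) C2 w" "w r $ 1 \<noteq> 0" "w r $ 2 = 0"
      using N.ex_unitary_C2_axis[OF hdim_H r] by blast
    have "w (block n (k n) x) $ 2 = 0" if "x \<in> carrier (H (k n))" for x
    proof -
      have "block n (k n) x \<in> range (\<lambda>c. c \<odot>\<^bsub>H n\<^esub> r)"
        using that by (simp flip: range)
      then obtain c where "block n (k n) x = c \<odot>\<^bsub>H n\<^esub> r"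
        by blast
      then show ?thesis
        using r(1) w(3) by (simp add: unitary_smult[OF w(1)])
    qed
    moreover have "w (block n (l n) y) $ 1 = 0" if y: "y \<in> carrier (H (l n))" for y
    proof -
      \<comment> \<open>The generator \<open>r\<close> is itself attained by the first block, so
        values of the other block are orthogonal to it. As \<open>w r\<close> is a nonzero vector on
        the first axis, their first coordinate vanishes.\<close>
      have "1 \<odot>\<^bsub>H n\<^esub> r \<in> block n (k n) ` carrier (H (k n))"
        unfolding range by blast
      then obtain x where x: "x \<in> carrier (H (k n))" "r = block n (k n) x"
        using r(1) by auto
      have "hinner C2 (w r) (w (block n (l n) y)) = 0"
        using ranges_orthogonal[OF x(1) y kl] x(2) r(1) block_carrier[OF y]
        by (simp add: unitary_hinner[OF w(1)])
      then show ?thesis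
        using w(2,3) by (simp add: hinner_C2)
    qed
    ultimately show ?thesis
      using w(1) by blast
  qed
  then show ?thesis
    using that by metis
qed

text \<open>The frame is described by the preimages of the standard basis vectors, since their
  images under a block are the columns of its matrix. The order of the neighbours separates
  \<open>class_C2\<close> from \<open>class_C4\<close>.\<close>

lemma ex_kernel_frame:
  assumes kl: "\<And>n. k n = n + 1 \<and> l n = n - 1 \<or> k n = n - 1 \<and> l n = n + 1"
  obtains w :: "int \<Rightarrow> 'a \<Rightarrow> complex^2"
  where "\<And>n. unitary (H n) C2 (w n)"
    and "\<And>n. block (k n) n (inv_into (carrier (H n)) (w n) (axis 1 1)) = \<zero>\<^bsub>H (k n)\<^esub>"
    and "\<And>n. block (l n) n (inv_into (carrier (H n)) (w n) (axis 2 1)) = \<zero>\<^bsub>H (l n)\<^esub>"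
proof -
  have "\<exists>w :: 'a \<Rightarrow> complex^2. unitary (H n) C2 w \<and>
    block (k n) n (inv_into (carrier (H n)) w (axis 1 1)) = \<zero>\<^bsub>H (k n)\<^esub> \<and>
    block (l n) n (inv_into (carrier (H n)) w (axis 2 1)) = \<zero>\<^bsub>H (l n)\<^esub>" for n
  proof -
    interpret N: hilbert_space "H n"
      by (rule hilbert) simp
    have ker: "\<exists>s. s \<in> carrier (H n) \<and> s \<noteq> \<zero>\<^bsub>H n\<^esub> \<and> block m n s = \<zero>\<^bsub>H m\<^esub>"
      if m: "m = n + 1 \<or> m = n - 1" for m
    proof -
      obtain r where r: "r \<in> carrier (H m)"
        and range: "block m n ` carrier (H n) = range (\<lambda>c. c \<odot>\<^bsub>H m\<^esub> r)"
        using block_range[OF m] by metis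
      show ?thesis
      proof (rule N.ex_nonzero_kernel[OF hdim_H module_summand[of m]])
        show "block m n ` carrier (H n) \<subseteq> range (\<lambda>c. c \<odot>\<^bsub>H m\<^esub> r)"
          using range by simp
      qed (simp_all add: block_add block_smult r, blast)
    qed
    obtain s where s: "s \<in> carrier (H n)" "s \<noteq> \<zero>\<^bsub>H n\<^esub>" "block (k n) n s = \<zero>\<^bsub>H (k n)\<^esub>"
      using ker[of "k n"] kl[of n] by auto
    obtain t where t: "t \<in> carrier (H n)" "t \<noteq> \<zero>\<^bsub>H n\<^esub>" "block (l n) n t = \<zero>\<^bsub>H (l n)\<^esub>"
      using ker[of "l n"] kl[of n] by auto
    obtain w :: "'a \<Rightarrow> complex^2" where w: "unitary (H n) C2 w" "w s $ 1 \<noteq> 0" "w s $ 2 = 0"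
      using N.ex_unitary_C2_axis[OF hdim_H s(1,2)] by blast
    have "hinner C2 (w s) (w t) = 0"
      using kernels_orthogonal[OF s(1,3) t(1,3) kl] s(1) t(1) by (simp add: unitary_hinner[OF w(1)])
    then have t1: "w t $ 1 = 0"
      using w(2,3) by (simp add: hinner_C2)
    \<comment> \<open>A nonzero \<open>w t\<close> orthogonal to the first axis spans the second, so
      both basis vectors are multiples of images of kernel vectors.\<close>
    have "w t \<noteq> 0"
      using unitary_eq_zero_iff[OF w(1) N.complex_module_axioms complex_module_C2 t(1)] t(2) by simp
    then have t2: "w t $ 2 \<noteq> 0"
      using t1 by (auto simp: vec_eq_iff forall_2)
    have inv: "inv_into (carrier (H n)) w (a *s w z) = a \<odot>\<^bsub>H n\<^esub> z"
      if "z \<in> carrier (H n)" for a z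
      using unitary_inv_left[OF w(1), of "a \<odot>\<^bsub>H n\<^esub> z"] that by (simp add: unitary_smult[OF w(1)])
    have "axis 1 1 = inverse (w s $ 1) *s w s" "axis 2 1 = inverse (w t $ 2) *s w t"
      using w(2,3) t1 t2 by (simp_all add: vec_eq_iff forall_2 axis_def)
    then have
      "block (k n) n (inv_into (carrier (H n)) w (axis 1 1)) = \<zero>\<^bsub>H (k n)\<^esub>"
      "block (l n) n (inv_into (carrier (H n)) w (axis 2 1)) = \<zero>\<^bsub>H (l n)\<^esub>"
      using s(1,3) t(1,3)
      by (simp_all add: inv block_smult complex_module.smult_zero module_summand)
    then show ?thesis
      using w(1) by blast
  qed
  then show ?thesis
    using that by metis
qed

end

section \<open>Matrices of the blocks in a chosen frame\<close>

locale framed_walk = line_walk H U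
  for H :: "int \<Rightarrow> 'a inner_space" and U :: "(int \<Rightarrow> 'a) \<Rightarrow> (int \<Rightarrow> 'a)" +
  fixes w :: "int \<Rightarrow> 'a \<Rightarrow> complex^2"
  assumes frame: "unitary (H n) C2 (w n)"

sublocale framed_walk \<subseteq> F: unitary_family UNIV H "\<lambda>_. C2" w
  by (intro unitary_family.intro hilbert_family.intro unitary_family_axioms.intro)
    (auto simp: hilbert frame hilbert_space_C2)

context framed_walk
begin

definition coord_block :: "int \<Rightarrow> int \<Rightarrow> complex^2 \<Rightarrow> complex^2" where
  "coord_block m n v = w m (block m n (inv_into (carrier (H n)) (w n) v))"

definition block_matrix :: "int \<Rightarrow> int \<Rightarrow> complex^2^2" where
  "block_matrix m n = mat2 (coord_block m n (axis 1 1) $ 1) (coord_block m n (axis 2 1) $ 1)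
     (coord_block m n (axis 1 1) $ 2) (coord_block m n (axis 2 1) $ 2)"

lemma one_dim_walk_conj_walk: "one_dim_walk (\<lambda>_. C2) (F.conj_walk U)"
proof -
  \<comment> \<open>The dimension of \<open>C2\<close> is transported from \<open>H 0\<close> along
    the unitary \<open>w 0\<close>.\<close>
  have "hdim C2 (carrier C2) = 2"
    using hdim_unitary_image[OF frame module_summand complex_module_C2, of 0 "carrier (H 0)"]
      F.w_image[of 0] hdim_H[of 0] by simp
  moreover have "walk_edges UNIV (\<lambda>_. C2) (F.conj_walk U) = walk_edges UNIV H U"
    by (simp add: walk_edges_def F.edge_card_conj_walk[OF unitary_U])
  ultimately show ?thesis
    using walk
    by (simp add: one_dim_walk_def quantum_walk_def separable_hilbert_space_C2
        F.unitary_conj_walk F.edge_card_conj_walk[OF unitary_U])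
qed

text \<open>A linear map of \<open>complex^2\<close> is determined by its values on the two basis
  vectors, which are the columns of \<open>block_matrix\<close>.\<close>

lemma coord_block_eq: "coord_block m n v = block_matrix m n *v v"
proof -
  note inv = unitary_inv[OF frame module_summand[OF UNIV_I], of n]
  let ?V = "inv_into (carrier (H n)) (w n)"
  have V: "?V u \<in> carrier (H n)" for u
    using unitary_carrier[OF inv, of u] by simp
  interpret N: complex_module "H n"
    by (simp add: module_summand)
  have "v = v $ 1 *s axis 1 1 + v $ 2 *s axis 2 1"
    by (simp add: vec_eq_iff forall_2 axis_def)
  then have "?V v = v $ 1 \<odot>\<^bsub>H n\<^esub> ?V (axis 1 1) \<oplus>\<^bsub>H n\<^esub> v $ 2 \<odot>\<^bsub>H n\<^esub> ?V (axis 2 1)"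
    using unitary_add[OF inv, of "v $ 1 *s axis 1 1" "v $ 2 *s axis 2 1"]
      unitary_smult[OF inv, of "axis 1 1" "v $ 1"] unitary_smult[OF inv, of "axis 2 1" "v $ 2"]
    by simp
  then have "coord_block m n v =
      v $ 1 *s coord_block m n (axis 1 1) + v $ 2 *s coord_block m n (axis 2 1)"
    using V unitary_add[OF frame, of _ m] unitary_smult[OF frame, of _ m]
    by (simp add: coord_block_def block_add block_smult block_carrier complex_module.smult_carrier
        module_summand)
  then show ?thesis
    by (simp add: block_matrix_def mat2_def matrix_vector_mult_def vec_eq_iff forall_2 sum_2
        mult.commute)
qed

lemma walk_block_conj_walk_eq:
  assumes \<psi>: "\<psi> \<in> carrier C2_sum"
  shows "walk_block UNIV (\<lambda>_. C2) (F.conj_walk U) m n \<psi> = ketbra m n (block_matrix m n) \<psi>"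
proof -
  have f: "F.W_inv \<psi> \<in> carrier S" "F.W (F.W_inv \<psi>) = \<psi>"
    using F.W_inv_carrier[OF \<psi>] F.W_W_inv[OF \<psi>] .
  have fn: "F.W_inv \<psi> n \<in> carrier (H n)"
    using f(1) by (simp add: component_carrier)
  have "F.W_inv \<psi> n = inv_into (carrier (H n)) (w n) (\<psi> n)"
    using unitary_inv_left[OF frame fn] F.W_component[of n "F.W_inv \<psi>"] f(2) by simp
  then have "walk_block UNIV (\<lambda>_. C2) (F.conj_walk U) m n \<psi> =
      emb UNIV (\<lambda>_. C2) m (coord_block m n (\<psi> n))"
    using fn f(1) by (simp add: F.walk_block_conj_walk[OF unitary_U _ _ \<psi>] walk_block_eq F.W_emb
        block_carrier coord_block_def)
  then show ?thesis
    by (simp add: coord_block_eq ketbra_def emb_def fun_eq_iff)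
qed

text \<open>Leaves only the shapes of the matrices to be checked. In each of the four classes the
  left block involves two coefficient families and the right block the other two, so the surviving
  entries can be taken as coefficients without conflict.\<close>

lemma shape_classI:
  assumes "\<And>n. block_matrix (n - 1) n = L (a n) (b n) (c n) (d n)"
    and "\<And>n. block_matrix (n + 1) n = R (a n) (b n) (c n) (d n)"
  shows "\<exists>U'\<in>shape_class L R. unitary_equivalent UNIV H U UNIV (\<lambda>_. C2) U'"
proof
  show "unitary_equivalent UNIV H U UNIV (\<lambda>_. C2) (F.conj_walk U)"
    by (rule F.unitary_equivalent_conj_walk)
  show "F.conj_walk U \<in> shape_class L R"
    unfolding shape_class_def
    by (auto simp: one_dim_walk_conj_walk walk_block_conj_walk_eq assms)
qed

lemma coord_block_row:
  assumes "\<And>x. x \<in> carrier (H n) \<Longrightarrow> w m (block m n x) $ i = 0"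
  shows "coord_block m n v $ i = 0"
  unfolding coord_block_def by (intro assms unitary_inv_carrier[OF frame]) simp

lemma coord_block_kernel:
  "block m n (inv_into (carrier (H n)) (w n) v) = \<zero>\<^bsub>H m\<^esub> \<Longrightarrow> coord_block m n v = 0"
  using F.w_zero[of m] by (simp add: coord_block_def)

end

section \<open>The four classes from range frames and kernel frames\<close>

theorem theorem5p1:
  fixes H :: "int \<Rightarrow> 'a inner_space"
    and U :: "(int \<Rightarrow> 'a) \<Rightarrow> (int \<Rightarrow> 'a)"
  assumes "one_dim_walk H U"
  shows "\<forall>\<C> \<in> {class_C1, class_C2, class_C3, class_C4}.
           \<exists>U' \<in> \<C>. unitary_equivalent UNIV H U UNIV (\<lambda>_. C2) U'"
proof -
  interpret line_walk H U
    by unfold_locales fact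
  have "\<exists>U'\<in>class_C1. unitary_equivalent UNIV H U UNIV (\<lambda>_. C2) U'"
  proof -
    obtain w :: "int \<Rightarrow> 'a \<Rightarrow> complex^2" where w: "\<And>n. unitary (H n) C2 (w n)"
      and range: "\<And>n x. x \<in> carrier (H (n + 1)) \<Longrightarrow> w n (block n (n + 1) x) $ 2 = 0"
        "\<And>n x. x \<in> carrier (H (n - 1)) \<Longrightarrow> w n (block n (n - 1) x) $ 1 = 0"
      by (rule ex_range_frame[of "\<lambda>n. n + 1" "\<lambda>n. n - 1"]) (simp, rule that)
    interpret framed_walk H U w
      by unfold_locales (rule w)
    \<comment> \<open>The frame facts are indexed by the target site while the shapes are indexed by
      the source, so they are used at \<open>n - 1\<close> and at \<open>n + 1\<close>: the source
      \<open>n\<close> is the right neighbour of the first and the left neighbour of the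
      second.\<close>
    have "coord_block (n - 1) n v $ 2 = 0" "coord_block (n + 1) n v $ 1 = 0" for n v
      using range(1)[of _ "n - 1"] range(2)[of _ "n + 1"] by (auto intro!: coord_block_row)
    then show ?thesis
      unfolding class_C1_def by (intro shape_classI) (simp_all add: block_matrix_def)
  qed
  moreover have "\<exists>U'\<in>class_C3. unitary_equivalent UNIV H U UNIV (\<lambda>_. C2) U'"
  proof -
    obtain w :: "int \<Rightarrow> 'a \<Rightarrow> complex^2" where w: "\<And>n. unitary (H n) C2 (w n)"
      and range: "\<And>n x. x \<in> carrier (H (n - 1)) \<Longrightarrow> w n (block n (n - 1) x) $ 2 = 0"
        "\<And>n x. x \<in> carrier (H (n + 1)) \<Longrightarrow> w n (block n (n + 1) x) $ 1 = 0"
      by (rule ex_range_frame[of "\<lambda>n. n - 1" "\<lambda>n. n + 1"]) (simp, rule that)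
    interpret framed_walk H U w
      by unfold_locales (rule w)
    \<comment> \<open>Exchanging the neighbours in the frame exchanges the axes, so in each block
      the other row vanishes.\<close>
    have "coord_block (n - 1) n v $ 1 = 0" "coord_block (n + 1) n v $ 2 = 0" for n v
      using range(1)[of _ "n + 1"] range(2)[of _ "n - 1"] by (auto intro!: coord_block_row)
    then show ?thesis
      unfolding class_C3_def by (intro shape_classI) (simp_all add: block_matrix_def)
  qed
  moreover have "\<exists>U'\<in>class_C2. unitary_equivalent UNIV H U UNIV (\<lambda>_. C2) U'"
  proof -
    obtain w :: "int \<Rightarrow> 'a \<Rightarrow> complex^2" where w: "\<And>n. unitary (H n) C2 (w n)"
      and kernel:
        "\<And>n. block (n + 1) n (inv_into (carrier (H n)) (w n) (axis 1 1)) = \<zero>\<^bsub>H (n + 1)\<^esub>"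
        "\<And>n. block (n - 1) n (inv_into (carrier (H n)) (w n) (axis 2 1)) = \<zero>\<^bsub>H (n - 1)\<^esub>"
      by (rule ex_kernel_frame[of "\<lambda>n. n + 1" "\<lambda>n. n - 1"]) (simp, rule that)
    interpret framed_walk H U w
      by unfold_locales (rule w)
    \<comment> \<open>The first basis vector is killed on the way to \<open>n + 1\<close> and the
      second on the way to \<open>n - 1\<close>, which empties the first column of the right block
      and the second of the left block.\<close>
    show ?thesis
      unfolding class_C2_def using kernel[THEN coord_block_kernel]
      by (intro shape_classI) (simp_all add: block_matrix_def)
  qed
  moreover have "\<exists>U'\<in>class_C4. unitary_equivalent UNIV H U UNIV (\<lambda>_. C2) U'"
  proof -
    obtain w :: "int \<Rightarrow> 'a \<Rightarrow> complex^2" where w: "\<And>n. unitary (H n) C2 (w n)"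
      and kernel:
        "\<And>n. block (n - 1) n (inv_into (carrier (H n)) (w n) (axis 1 1)) = \<zero>\<^bsub>H (n - 1)\<^esub>"
        "\<And>n. block (n + 1) n (inv_into (carrier (H n)) (w n) (axis 2 1)) = \<zero>\<^bsub>H (n + 1)\<^esub>"
      by (rule ex_kernel_frame[of "\<lambda>n. n - 1" "\<lambda>n. n + 1"]) (simp, rule that)
    interpret framed_walk H U w
      by unfold_locales (rule w)
    \<comment> \<open>With the kernels on exchanged axes, the first column of the left block and the
      second of the right block vanish.\<close>
    show ?thesis
      unfolding class_C4_def using kernel[THEN coord_block_kernel]
      by (intro shape_classI) (simp_all add: block_matrix_def)
  qed
  ultimately show ?thesis
    by simp
qed

end
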